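(* For every $k\in(0,1)$ there exists a reduced quasiconformal mapping $f\colon\mathbb{C}\to\mathbb{C}$ which satisfies $|f_{\bar z}|\le k\,\operatorname{Re} f_z$ a.e. in $\mathbb{C}$ (with this given $k$) but does not have bounded variation on any nontrivial interval $[a,b]\subset\mathbb{R}$. Furthermore, $f$ can be chosen so that $f_{\bar z}\in L^\infty(\mathbb{C})$, $\operatorname{Re} f_z\in L^\infty(\mathbb{C})$, and $\operatorname{Re} f(x)=x$ for all $x\in\mathbb{R}$.
   Context: A homeomorphism $f\colon\mathbb{C}\to\mathbb{C}$ belonging to $W^{1,2}_{\mathrm{loc}}(\mathbb{C};\mathbb{C})$ is called reduced quasiconformal if there is a constant $0<k<1$ such that $|f_{\bar z}|\le k\,\operatorname{Re} f_z$ a.e. in $\mathbb{C}$, where $f_z=\tfrac12(f_x-if_y)$ and $f_{\bar z}=\tfrac12(f_x+if_y)$ are the (weak) complex derivatives. A mapping $f$ has bounded variation on $[a,b]\subset\mathbb{R}$ if $\sup\sum_{j=1}^N|f(a_j)-f(a_{j-1})|<\infty$, the supremum being over all $N\ge1$ and all partitions $a=a_0<a_1<\dots<a_N=b$. The interval $[a,b]$ is nontrivial if $a<b$. *)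

theory Defs
  imports "HOL-Analysis.Analysis"
begin

text \<open>The plane is \<^typ>\<open>complex\<close> regarded as a two-dimensional real Euclidean space, with
  \<^term>\<open>lebesgue :: complex measure\<close> as area measure.\<close>

primrec Ck_plane :: "nat \<Rightarrow> (complex \<Rightarrow> real) \<Rightarrow> bool" where
  "Ck_plane 0 \<phi> \<longleftrightarrow> continuous_on UNIV \<phi>"
| "Ck_plane (Suc n) \<phi> \<longleftrightarrow>
     (\<exists>\<phi>x \<phi>y. (\<forall>z. (\<phi> has_derivative (\<lambda>h. Re h * \<phi>x z + Im h * \<phi>y z)) (at z)) \<and>
              Ck_plane n \<phi>x \<and> Ck_plane n \<phi>y)"

definition test_fun :: "(complex \<Rightarrow> real) \<Rightarrow> bool" where
  "test_fun \<phi> \<longleftrightarrow> (\<forall>n. Ck_plane n \<phi>) \<and> compact (closure (support_on UNIV \<phi>))"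

definition L1loc :: "(complex \<Rightarrow> complex) \<Rightarrow> bool" where
  "L1loc f \<longleftrightarrow> f \<in> borel_measurable lebesgue \<and> (\<forall>K. compact K \<longrightarrow> set_integrable lebesgue K f)"

definition L2loc :: "(complex \<Rightarrow> complex) \<Rightarrow> bool" where
  "L2loc f \<longleftrightarrow> f \<in> borel_measurable lebesgue \<and>
     (\<forall>K. compact K \<longrightarrow> set_integrable lebesgue K (\<lambda>z. (norm (f z))\<^sup>2))"

definition Linfty :: "(complex \<Rightarrow> 'b::{real_normed_vector}) \<Rightarrow> bool" where
  "Linfty g \<longleftrightarrow> g \<in> borel_measurable lebesgue \<and> (\<exists>M. AE z in lebesgue. norm (g z) \<le> M)"

text \<open>The direction \<open>v\<close> is real: \<open>v = 1\<close> gives the weak \<open>x\<close>-derivative and \<open>v = \<i>\<close> the weak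
  \<open>y\<close>-derivative.  Testing against real-valued functions suffices by linearity.\<close>

definition weak_derivative :: "complex \<Rightarrow> (complex \<Rightarrow> complex) \<Rightarrow> (complex \<Rightarrow> complex) \<Rightarrow> bool" where
  "weak_derivative v f g \<longleftrightarrow> L1loc f \<and> L1loc g \<and>
     (\<forall>\<phi>. test_fun \<phi> \<longrightarrow>
        (\<integral>z. frechet_derivative \<phi> (at z) v *\<^sub>R f z \<partial>lebesgue) = - (\<integral>z. \<phi> z *\<^sub>R g z \<partial>lebesgue))"

text \<open>Weak derivatives are determined only almost everywhere, so representatives \<open>fx\<close>, \<open>fy\<close> of the
  two weak partial derivatives are carried along as arguments; every condition imposed on them
  below is invariant under changes on null sets.\<close>

definition W12loc_partials ::
    "(complex \<Rightarrow> complex) \<Rightarrow> (complex \<Rightarrow> complex) \<Rightarrow> (complex \<Rightarrow> complex) \<Rightarrow> bool" where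
  "W12loc_partials f fx fy \<longleftrightarrow>
     L2loc f \<and> L2loc fx \<and> L2loc fy \<and> weak_derivative 1 f fx \<and> weak_derivative \<i> f fy"

definition wirtinger_z :: "(complex \<Rightarrow> complex) \<Rightarrow> (complex \<Rightarrow> complex) \<Rightarrow> complex \<Rightarrow> complex" where
  "wirtinger_z fx fy z = (fx z - \<i> * fy z) / 2"

definition wirtinger_zbar :: "(complex \<Rightarrow> complex) \<Rightarrow> (complex \<Rightarrow> complex) \<Rightarrow> complex \<Rightarrow> complex" where
  "wirtinger_zbar fx fy z = (fx z + \<i> * fy z) / 2"

definition reduced_ineq :: "real \<Rightarrow> (complex \<Rightarrow> complex) \<Rightarrow> (complex \<Rightarrow> complex) \<Rightarrow> bool" where
  "reduced_ineq k fx fy \<longleftrightarrow>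
     (AE z in lebesgue. norm (wirtinger_zbar fx fy z) \<le> k * Re (wirtinger_z fx fy z))"

definition reduced_quasiconformal :: "(complex \<Rightarrow> complex) \<Rightarrow> bool" where
  "reduced_quasiconformal f \<longleftrightarrow>
     (\<exists>g. homeomorphism UNIV UNIV f g) \<and>
     (\<exists>fx fy. W12loc_partials f fx fy \<and> (\<exists>k. 0 < k \<and> k < 1 \<and> reduced_ineq k fx fy))"

definition bounded_variation_on :: "real \<Rightarrow> real \<Rightarrow> (real \<Rightarrow> complex) \<Rightarrow> bool" where
  "bounded_variation_on a b h \<longleftrightarrow>
     bdd_above {\<Sum>j=1..N. norm (h (p j) - h (p (j - 1))) | (N::nat) (p::nat \<Rightarrow> real).
       N \<ge> 1 \<and> p 0 = a \<and> p N = b \<and> (\<forall>j\<in>{1..N}. p (j - 1) < p j)}"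

end

theory Submission
  imports Defs
begin

text \<open>Write the derivative of \<open>f\<close> as the real linear map \<open>h \<mapsto> f\<^sub>z h + f\<^sub>z\<^sub>b\<^sub>a\<^sub>r cnj h\<close>.  The reduced
  inequality involves \<open>f\<^sub>z\<^sub>b\<^sub>a\<^sub>r\<close> and \<open>Re f\<^sub>z\<close>, which make up the symmetric part of this matrix, and
  leaves the rotation part \<open>Im f\<^sub>z\<close> free.  It therefore suffices to find a displacement field \<open>u\<close> whose
  symmetric gradient is bounded although \<open>u\<close> is purely imaginary and of unbounded variation on every
  real interval: for small \<open>e > 0\<close> the map \<open>f z = z + e u(z)\<close> then satisfies the inequality for the
  given \<open>k\<close>.

  The field is a lacunary sum \<open>u(z) = \<Sum>\<^sub>j H(\<omega>\<^sub>j z) / \<omega>\<^sub>j\<close> with \<open>\<omega>\<^sub>j = 2 \<pi> 8\<^sup>j\<close>, where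
  \<open>H(x + i y) = (y sin x + i cos x) / (1 + y\<^sup>2)\<close> (\<open>profile\<close>).  On the real axis this is \<open>i\<close> times the
  Weierstrass function \<open>\<Sum>\<^sub>j cos(\<omega>\<^sub>j x) / \<omega>\<^sub>j\<close>.  The real part \<open>y sin x / (1 + y\<^sup>2)\<close> is there to cancel the
  shear \<open>\<partial>\<^sub>x Im H\<close> at \<open>y = 0\<close>; as a result the symmetric gradient of \<open>H\<close> is of order
  \<open>|y| / (1 + y\<^sup>2)\<close> (\<open>profile_wirtinger_bounds\<close>).  It is small both near the axis and far from it, so
  at each point only the waves with \<open>\<omega>\<^sub>j |y|\<close> of order one contribute appreciably, and the sum over \<open>j\<close> is bounded
  by a constant (\<open>sum_decay_le\<close>).  The full gradient of the sum is unbounded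
  near the axis; the integrable bound \<open>|y| powr (-1/3)\<close> is all that is needed to pass to the
  limit in the weak derivatives (\<open>weak_derivative_limit\<close>).

  The bound on the symmetric part also makes \<open>f\<close> strongly monotone,
  \<open>(f z - f w) \<bullet> (z - w) \<ge> c |z - w|\<^sup>2\<close> (\<open>limit_map_strongly_monotone\<close>), and a continuous strongly
  monotone map of a Euclidean space is a homeomorphism by invariance of domain.

  Unbounded variation is a statement about the polygons inscribed in the curve \<open>f(\<real>)\<close>, which is the
  graph of a Weierstrass function.  On every cell \<open>[m/8\<^sup>N, (m+1)/8\<^sup>N]\<close> the midpoint lies off the chord by
  a fixed multiple of the cell length (\<open>limit_map_bent\<close>): waves of higher frequency are invisible
  at the three points, the wave number \<open>N\<close> contributes a full swing, and those of lower frequency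
  are too smooth to compensate.  If the variation on an interval were finite, at least half of the
  cells would have chords of bounded slope, and on these inserting the midpoint gains a fixed
  fraction of the cell length.  Each refinement by a factor \<open>8\<close> would thus add a fixed amount to the
  polygonal length, which contradicts its boundedness (\<open>not_bounded_variation_if_bent\<close>).\<close>

section \<open>Polygonal length and unbounded variation\<close>

text \<open>The length of a broken path from \<open>-w\<close> to \<open>w\<close> through \<open>i d\<close>, compared with the straight one.  Squaring
  the sum gives \<open>2 |w|\<^sup>2 + 2 d\<^sup>2\<close> plus twice \<open>|w\<^sup>2 + d\<^sup>2|\<close>, and the latter is bounded below by the
  component of \<open>w\<^sup>2 + d\<^sup>2\<close> in the direction of \<open>w\<^sup>2\<close>.\<close>

lemma norm_chords_ge:
  fixes w :: complex and d :: real
  assumes "0 < Re w"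
  shows "4 * (cmod w)\<^sup>2 + 4 * d\<^sup>2 * (Re w)\<^sup>2 / (cmod w)\<^sup>2
           \<le> (cmod (w + \<i> * d) + cmod (w - \<i> * d))\<^sup>2"
proof -
  define x y where "x = Re w" and "y = Im w"
  define r where "r = (cmod w)\<^sup>2"
  have r: "r = x\<^sup>2 + y\<^sup>2" by (simp add: r_def x_def y_def cmod_power2)
  have "x > 0" using assms by (simp add: x_def)
  then have rpos: "r > 0" unfolding r by (simp add: add_pos_nonneg)
  have prod: "cmod (w + \<i> * d) * cmod (w - \<i> * d) = cmod (w\<^sup>2 + d\<^sup>2)"
    by (simp add: norm_mult[symmetric] algebra_simps power2_eq_square)
  have cn: "cmod ((cnj w)\<^sup>2) = r" by (simp add: norm_power r_def)
  have "Re ((w\<^sup>2 + d\<^sup>2) * (cnj w)\<^sup>2) = r\<^sup>2 + d\<^sup>2 * (x\<^sup>2 - y\<^sup>2)"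
    unfolding r by (simp add: x_def y_def power2_eq_square algebra_simps)
  moreover have "Re ((w\<^sup>2 + d\<^sup>2) * (cnj w)\<^sup>2) \<le> cmod (w\<^sup>2 + d\<^sup>2) * r"
    using complex_Re_le_cmod[of "(w\<^sup>2 + d\<^sup>2) * (cnj w)\<^sup>2"] unfolding norm_mult cn .
  ultimately have "r\<^sup>2 + d\<^sup>2 * (x\<^sup>2 - y\<^sup>2) \<le> cmod (w\<^sup>2 + d\<^sup>2) * r" by simp
  then have *: "(r\<^sup>2 + d\<^sup>2 * (x\<^sup>2 - y\<^sup>2)) / r \<le> cmod (w\<^sup>2 + d\<^sup>2)"
    using rpos by (simp add: divide_le_eq)
  have "(cmod (w + \<i> * d))\<^sup>2 + (cmod (w - \<i> * d))\<^sup>2 = 2 * r + 2 * d\<^sup>2"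
    unfolding r cmod_power2 by (simp add: x_def y_def power2_eq_square algebra_simps)
  then have "(cmod (w + \<i> * d) + cmod (w - \<i> * d))\<^sup>2 = 2 * r + 2 * d\<^sup>2 + 2 * cmod (w\<^sup>2 + d\<^sup>2)"
    by (simp add: power2_sum prod mult.assoc)
  also have "\<dots> \<ge> 2 * r + 2 * d\<^sup>2 + 2 * ((r\<^sup>2 + d\<^sup>2 * (x\<^sup>2 - y\<^sup>2)) / r)"
    by (intro add_left_mono mult_left_mono *) auto
  also have "2 * r + 2 * d\<^sup>2 + 2 * ((r\<^sup>2 + d\<^sup>2 * (x\<^sup>2 - y\<^sup>2)) / r) = 4 * r + 4 * d\<^sup>2 * x\<^sup>2 / r"
  proof -
    have xy: "x\<^sup>2 - y\<^sup>2 = 2 * x\<^sup>2 - r" using r by simp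
    have "r\<^sup>2 + d\<^sup>2 * (x\<^sup>2 - y\<^sup>2) = r * (r - d\<^sup>2) + 2 * d\<^sup>2 * x\<^sup>2"
      unfolding xy by (simp add: power2_eq_square algebra_simps)
    then show ?thesis using rpos by (simp add: add_divide_distrib)
  qed
  finally show ?thesis by (simp add: r_def x_def)
qed

text \<open>The first-order effects of moving the midpoint vertically cancel between the two halves of the
  chord.  The second-order gain \<open>d\<^sup>2 (Re w)\<^sup>2 / |w|\<^sup>3\<close> is proportional to the horizontal extent as soon
  as the slope is bounded by \<open>K\<close> and the displacement is comparable with the extent.\<close>

lemma chord_gain:
  fixes K c :: real
  assumes K: "1 \<le> K" and c: "0 < c"
  obtains \<delta> where "0 < \<delta>"
    "\<And>w d. 0 < Re w \<Longrightarrow> cmod w \<le> K * Re w \<Longrightarrow> c * Re w \<le> \<bar>d\<bar> \<Longrightarrow>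
       2 * cmod w + \<delta> * Re w \<le> cmod (w + \<i> * complex_of_real d) + cmod (w - \<i> * complex_of_real d)"
proof -
  define \<delta> where "\<delta> = min 1 (c\<^sup>2 / (K\<^sup>2 * (K + 1)))"
  have dpos: "0 < \<delta>" using K c by (simp add: \<delta>_def)
  have "\<delta> \<le> (c\<^sup>2 / K\<^sup>2) / (K + 1)" by (simp add: \<delta>_def)
  then have dK: "\<delta> * (K + 1) \<le> c\<^sup>2 / K\<^sup>2"
    by (rule pos_le_divide_eq[THEN iffD1, rotated]) (use K in simp)
  have d1: "\<delta> \<le> 1" by (simp add: \<delta>_def)
  show ?thesis
  proof (rule that[OF dpos])
    fix w :: complex and d :: real
    assume w: "0 < Re w" and wK: "cmod w \<le> K * Re w" and d: "c * Re w \<le> \<bar>d\<bar>"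
    define x r where "x = Re w" and "r = cmod w"
    have x: "x > 0" and rx: "x \<le> r" and rK: "r \<le> K * x" and dx: "c * x \<le> \<bar>d\<bar>"
      using w wK d complex_Re_le_cmod[of w] by (auto simp: x_def r_def)
    have r: "r > 0" using x rx by simp
    have "(c * x)\<^sup>2 \<le> d\<^sup>2" using dx x c by (simp add: abs_le_square_iff[symmetric])
    then have "(c * x)\<^sup>2 * x\<^sup>2 / r\<^sup>2 \<le> d\<^sup>2 * x\<^sup>2 / r\<^sup>2"
      by (intro divide_right_mono mult_right_mono) auto
    moreover have "(c * x)\<^sup>2 * x\<^sup>2 / (K * x)\<^sup>2 \<le> (c * x)\<^sup>2 * x\<^sup>2 / r\<^sup>2"
      using rK r x K by (intro divide_left_mono power_mono) auto
    moreover have "(c * x)\<^sup>2 * x\<^sup>2 / (K * x)\<^sup>2 = c\<^sup>2 / K\<^sup>2 * x\<^sup>2"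
      using x by (simp add: power2_eq_square)
    ultimately have e: "\<delta> * (K + 1) * x\<^sup>2 \<le> d\<^sup>2 * x\<^sup>2 / r\<^sup>2"
      using mult_right_mono[OF dK, of "x\<^sup>2"] by simp
    have lin: "\<delta> * x * r \<le> \<delta> * x * (K * x)" using dpos x rK by (intro mult_left_mono) auto
    have quad: "\<delta>\<^sup>2 * x\<^sup>2 \<le> \<delta> * x\<^sup>2"
      using d1 dpos by (intro mult_right_mono) (auto simp: power2_eq_square)
    have "0 \<le> \<delta> * x\<^sup>2" using dpos by simp
    moreover have "(2 * r + \<delta> * x)\<^sup>2 = 4 * r\<^sup>2 + 4 * (\<delta> * x * r) + \<delta>\<^sup>2 * x\<^sup>2"
      by (simp add: power2_eq_square algebra_simps)
    moreover have "\<delta> * (K + 1) * x\<^sup>2 = \<delta> * x * (K * x) + \<delta> * x\<^sup>2"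
      by (simp add: power2_eq_square algebra_simps)
    ultimately have "(2 * r + \<delta> * x)\<^sup>2 \<le> 4 * r\<^sup>2 + 4 * (\<delta> * (K + 1) * x\<^sup>2)"
      using lin quad by linarith
    also have "\<dots> \<le> 4 * r\<^sup>2 + 4 * d\<^sup>2 * x\<^sup>2 / r\<^sup>2" using e by simp
    also have "\<dots> \<le> (cmod (w + \<i> * d) + cmod (w - \<i> * d))\<^sup>2"
      using norm_chords_ge[OF w, of d] by (simp add: x_def r_def)
    finally show "2 * cmod w + \<delta> * Re w \<le> cmod (w + \<i> * d) + cmod (w - \<i> * d)"
      unfolding x_def r_def by (rule power2_le_imp_le) auto
  qed
qed

lemma sum_double:
  fixes h :: "nat \<Rightarrow> real"
  shows "(\<Sum>m<2 * n. h m) = (\<Sum>m<n. h (2 * m) + h (2 * m + 1))"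
  by (induction n) (auto simp: algebra_simps)

definition polygon_length :: "(real \<Rightarrow> complex) \<Rightarrow> real \<Rightarrow> real \<Rightarrow> nat \<Rightarrow> real" where
  "polygon_length g x l n = (\<Sum>m<n. cmod (g (x + real (m + 1) * l / n) - g (x + real m * l / n)))"

lemma polygon_length_double:
  assumes "0 < n"
  shows "polygon_length g x l (2 * n) =
    (\<Sum>m<n. cmod (g (x + (real m + 1/2) * l / n) - g (x + real m * l / n))
          + cmod (g (x + real (m + 1) * l / n) - g (x + (real m + 1/2) * l / n)))"
proof -
  have e1: "real (2 * m + 1) * l / real (2 * n) = (real m + 1/2) * l / n" for m
    using assms by (simp add: field_simps)
  have e2: "real (2 * m + 1 + 1) * l / real (2 * n) = real (m + 1) * l / n" for m
    using assms by (simp add: field_simps)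
  have e3: "real (2 * m) * l / real (2 * n) = real m * l / n" for m
    using assms by (simp add: field_simps)
  show ?thesis unfolding polygon_length_def sum_double e1 e2 e3 ..
qed

lemma polygon_length_double_ge:
  assumes "0 < n"
  shows "polygon_length g x l n \<le> polygon_length g x l (2 * n)"
  unfolding polygon_length_double[OF assms]
proof (unfold polygon_length_def, rule sum_mono)
  fix m
  show "cmod (g (x + real (m + 1) * l / n) - g (x + real m * l / n))
    \<le> cmod (g (x + (real m + 1/2) * l / n) - g (x + real m * l / n))
          + cmod (g (x + real (m + 1) * l / n) - g (x + (real m + 1/2) * l / n))"
    by (rule order_trans[OF _ norm_triangle_ineq]) (simp add: algebra_simps)
qed

text \<open>One refinement step.  If the polygon has length at most \<open>V\<close>, at most half of its \<open>n\<close> edges can be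
  longer than \<open>2 V / n\<close>.  The remaining edges have bounded slope, so that \<open>gain\<close> applies to each
  of them; on the long edges the triangle inequality is enough.\<close>

lemma polygon_length_double_gain:
  fixes g :: "real \<Rightarrow> complex"
  assumes n: "0 < n" and l: "0 < l" and V: "0 < V" and \<delta>: "0 \<le> \<delta>"
    and le: "polygon_length g x l n \<le> V"
    and Re_g: "\<And>t. Re (g t) = t"
    and dev: "\<And>m. c * (l / n) \<le> \<bar>Im (g (x + real m * l / n)) + Im (g (x + real (m + 1) * l / n))
                - 2 * Im (g (x + (real m + 1/2) * l / n))\<bar>"
    and gain: "\<And>w d. 0 < Re w \<Longrightarrow> cmod w \<le> (2 * V / l) * Re w \<Longrightarrow> c * Re w \<le> \<bar>d\<bar> \<Longrightarrow>
       2 * cmod w + \<delta> * Re w \<le> cmod (w + \<i> * complex_of_real d) + cmod (w - \<i> * complex_of_real d)"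
  shows "polygon_length g x l n + \<delta> * l / 4 \<le> polygon_length g x l (2 * n)"
proof -
  define A P where "A m = g (x + real m * l / n)" and "P m = g (x + (real m + 1/2) * l / n)" for m
  define t where "t m = cmod (A (m + 1) - A m)" for m
  \<comment> \<open>The edges of bounded slope.\<close>
  define G where "G = {m. m < n \<and> t m \<le> 2 * V / n}"
  have len: "polygon_length g x l n = (\<Sum>m<n. t m)"
    by (simp add: polygon_length_def t_def A_def)
  have tri: "t m \<le> cmod (P m - A m) + cmod (A (m + 1) - P m)" for m
    unfolding t_def by (rule order_trans[OF _ norm_triangle_ineq]) (simp add: algebra_simps)
  have good: "t m + \<delta> * (l / (2 * n)) \<le> cmod (P m - A m) + cmod (A (m + 1) - P m)" if "m \<in> G" for m
  proof -
    define w where "w = (A (m + 1) - A m) / 2"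
    define d where "d = Im (P m) - (Im (A m) + Im (A (m + 1))) / 2"
    have Rw: "Re w = l / (2 * n)" using n by (simp add: w_def A_def Re_g field_simps)
    have 1: "P m - A m = w + \<i> * d" and 2: "A (m + 1) - P m = w - \<i> * d"
      using n by (auto simp: complex_eq_iff w_def d_def A_def P_def Re_g field_simps)
    have "cmod w = t m / 2" by (simp add: w_def t_def norm_divide)
    also have "\<dots> \<le> V / n" using that by (simp add: G_def mult.commute)
    also have "\<dots> = (2 * V / l) * Re w" using l n by (simp add: Rw)
    finally have wb: "cmod w \<le> (2 * V / l) * Re w" .
    have "2 * d = 2 * Im (P m) - (Im (A m) + Im (A (m + 1)))" by (simp add: d_def field_simps)
    then have "c * (2 * Re w) \<le> \<bar>2 * d\<bar>"
      using dev[of m] n unfolding Rw A_def P_def by (simp only: abs_minus_commute)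
    then have db: "c * Re w \<le> \<bar>d\<bar>" by simp
    have "2 * cmod w = t m" by (simp add: w_def t_def norm_divide)
    with gain[OF _ wb db] n l show ?thesis unfolding 1 2 Rw by simp
  qed
  have card: "real n / 2 \<le> card G"
  proof -
    have "real (card ({..<n} - G)) * (2 * V / n) \<le> (\<Sum>m\<in>{..<n} - G. t m)"
      by (rule sum_bounded_below) (auto simp: G_def)
    also have "\<dots> \<le> (\<Sum>m<n. t m)" by (rule sum_mono2) (auto simp: t_def)
    also have "\<dots> \<le> V" using le len by simp
    finally have "real (card ({..<n} - G)) \<le> n / 2" using V n by (simp add: field_simps)
    moreover have "card ({..<n} - G) = n - card G" by (subst card_Diff_subset) (auto simp: G_def)
    ultimately show ?thesis by linarith
  qed
  have "(\<Sum>m<n. t m) + \<delta> * l / 4 \<le> (\<Sum>m<n. t m) + card G * (\<delta> * (l / (2 * n)))"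
  proof -
    have "\<delta> * l / 4 = (real n / 2) * (\<delta> * (l / (2 * n)))" using n by (simp add: field_simps)
    also have "\<dots> \<le> card G * (\<delta> * (l / (2 * n)))"
      using card \<delta> l by (intro mult_right_mono) auto
    finally show ?thesis by simp
  qed
  also have "\<dots> = (\<Sum>m<n. t m + (if m \<in> G then \<delta> * (l / (2 * n)) else 0))"
  proof -
    have "{..<n} \<inter> G = G" by (auto simp: G_def)
    then show ?thesis by (simp add: sum.distrib sum.If_cases)
  qed
  also have "\<dots> \<le> (\<Sum>m<n. cmod (P m - A m) + cmod (A (m + 1) - P m))"
    by (rule sum_mono) (use good tri in auto)
  finally show ?thesis
    unfolding polygon_length_double[OF n] len[symmetric] by (simp add: A_def P_def add.commute)
qed

text \<open>The interval \<open>[x, x + l]\<close> lies in the open interval \<open>(a, b)\<close>, so that adding \<open>a\<close> and \<open>b\<close> to the grid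
  gives a strictly increasing partition.\<close>

lemma polygon_length_le_variation:
  assumes bv: "bounded_variation_on a b g" and ab: "a < x" "x + l < b" and l: "0 < l"
  obtains V where "0 < V" "\<And>n. 0 < n \<Longrightarrow> polygon_length g x l n \<le> V"
proof -
  obtain V where V: "\<And>(N::nat) p. N \<ge> 1 \<Longrightarrow> p 0 = a \<Longrightarrow> p N = b \<Longrightarrow> \<forall>j\<in>{1..N}. p (j - 1) < p j \<Longrightarrow>
      (\<Sum>j=1..N. norm (g (p j) - g (p (j - 1)))) \<le> V"
  proof -
    obtain V where "\<forall>s\<in>{\<Sum>j=1..N. norm (g (p j) - g (p (j - 1))) | (N::nat) (p::nat \<Rightarrow> real).
       N \<ge> 1 \<and> p 0 = a \<and> p N = b \<and> (\<forall>j\<in>{1..N}. p (j - 1) < p j)}. s \<le> V"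
      using bv unfolding bounded_variation_on_def bdd_above_def by blast
    then have "(\<Sum>j=1..N. norm (g (p j) - g (p (j - 1)))) \<le> V"
      if "N \<ge> 1" "p 0 = a" "p N = b" "\<forall>j\<in>{1..N}. p (j - 1) < p j" for N :: nat and p
      by (rule bspec) (rule CollectI, rule exI[of _ N], rule exI[of _ p], use that in simp)
    then show ?thesis by (rule that)
  qed
  have "polygon_length g x l n \<le> max V 1" if n: "0 < n" for n
  proof -
    define p where "p j = (if j = 0 then a else if j = n + 2 then b else x + real (j - 1) * l / n)" for j
    have mono: "\<forall>j\<in>{1..n+2}. p (j - 1) < p j"
    proof
      fix j assume j: "j \<in> {1..n+2}"
      consider "j = 1" | "j = n + 2" | i where "j = i + 2" "i < n"
      proof -
        have "j = 1 \<or> j = n + 2 \<or> (j = (j - 2) + 2 \<and> j - 2 < n)" using j by auto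
        then show ?thesis using that by blast
      qed
      then show "p (j - 1) < p j"
      proof cases
        case 1 then show ?thesis using ab by (simp add: p_def)
      next
        case 2 then show ?thesis using ab n by (simp add: p_def)
      next
        case 3 then show ?thesis using l n by (simp add: p_def field_simps)
      qed
    qed
    have "polygon_length g x l n = (\<Sum>m<n. norm (g (p (m + 2)) - g (p (m + 2 - 1))))"
      unfolding polygon_length_def by (rule sum.cong) (auto simp: p_def)
    also have "\<dots> = (\<Sum>j\<in>(\<lambda>m. m + 2) ` {..<n}. norm (g (p j) - g (p (j - 1))))"
      by (subst sum.reindex) (auto simp: inj_on_def)
    also have "\<dots> \<le> (\<Sum>j=1..n+2. norm (g (p j) - g (p (j - 1))))"
      by (rule sum_mono2) auto
    also have "\<dots> \<le> V"
      by (rule V[OF _ _ _ mono]) (auto simp: p_def)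
    finally show ?thesis by simp
  qed
  then show ?thesis by (intro that[of "max V 1"]) auto
qed

text \<open>Inside \<open>[a, b]\<close> choose a cell of the grid of mesh \<open>8\<^sup>-\<^sup>i\<close>; all its subdivisions by powers of \<open>8\<close> are
  again cells of the given grids.  Passing from \<open>8\<^sup>N\<close> to \<open>8\<^sup>N\<^sup>+\<^sup>1\<close> cells takes three bisections: the first
  one gains a fixed length, and the other two do not lose any.\<close>

proposition not_bounded_variation_if_bent:
  fixes g :: "real \<Rightarrow> complex"
  assumes Re_g: "\<And>t. Re (g t) = t" and c: "0 < c"
    and bent: "\<And>(N::nat) (m::int). c / 8 ^ N \<le> \<bar>Im (g (m / 8 ^ N)) + Im (g ((m + 1) / 8 ^ N))
                - 2 * Im (g ((m + 1/2) / 8 ^ N))\<bar>"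
    and ab: "a < b"
  shows "\<not> bounded_variation_on a b g"
proof
  assume bv: "bounded_variation_on a b g"
  obtain i where i: "2 / (b - a) < 8 ^ i"
    using real_arch_pow[of 8 "2 / (b - a)"] by auto
  define l where "l = 1 / (8::real) ^ i"
  \<comment> \<open>The first grid point to the right of \<open>a\<close>.\<close>
  define p where "p = \<lfloor>a * 8 ^ i\<rfloor> + 1"
  define x where "x = p / 8 ^ i"
  have l: "0 < l" by (simp add: l_def)
  have l2: "2 * l < b - a" using i ab by (simp add: l_def field_simps)
  have "a * 8 ^ i < p" "p \<le> a * 8 ^ i + 1" unfolding p_def by linarith+
  then have "a < x" "x \<le> a + l" by (auto simp: x_def l_def field_simps)
  then have x: "a < x" "x + l < b" using l2 by auto
  obtain V where V: "0 < V" and le: "\<And>n. 0 < n \<Longrightarrow> polygon_length g x l n \<le> V"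
    using polygon_length_le_variation[OF bv x l] by blast
  define D where "D N = polygon_length g x l (8 ^ N)" for N
  have "1 \<le> 2 * V / l"
  proof -
    have "l \<le> cmod (g (x + l) - g x)"
      using complex_Re_le_cmod[of "g (x + l) - g x"] by (simp add: Re_g)
    also have "\<dots> = polygon_length g x l 1" by (simp add: polygon_length_def)
    also have "\<dots> \<le> V" by (rule le) simp
    finally show ?thesis using l V by (simp add: field_simps)
  qed
  from chord_gain[OF this c] obtain \<delta> where \<delta>: "0 < \<delta>" and gain:
    "\<And>w d. 0 < Re w \<Longrightarrow> cmod w \<le> (2 * V / l) * Re w \<Longrightarrow> c * Re w \<le> \<bar>d\<bar> \<Longrightarrow>
       2 * cmod w + \<delta> * Re w \<le> cmod (w + \<i> * complex_of_real d) + cmod (w - \<i> * complex_of_real d)"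
    by blast
  have step: "D N + \<delta> * l / 4 \<le> D (Suc N)" for N
  proof -
    let ?n = "8 ^ N :: nat"
    have pt: "x + (real m + s) * l / real ?n = (of_int (p * 8 ^ N + int m) + s) / 8 ^ (i + N)" for m s
      by (simp add: x_def l_def power_add field_simps)
    have "D N + \<delta> * l / 4 \<le> polygon_length g x l (2 * ?n)"
      unfolding D_def
    proof (rule polygon_length_double_gain[OF _ l V _ _ Re_g _ gain])
      fix m
      show "c * (l / real ?n) \<le> \<bar>Im (g (x + real m * l / real ?n)) + Im (g (x + real (m + 1) * l / real ?n))
                - 2 * Im (g (x + (real m + 1/2) * l / real ?n))\<bar>"
      proof -
        have "l / real ?n = 1 / 8 ^ (i + N)" by (simp add: l_def power_add)
        then show ?thesis
          using bent[of "i + N" "p * 8 ^ N + int m"] pt[of m 0] pt[of m 1] pt[of m "1/2"]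
          by (simp only: of_nat_add of_nat_1 add_0_right times_divide_eq_right mult_1_right)
      qed
    qed (use \<delta> le in auto)
    also have "\<dots> \<le> polygon_length g x l (2 * (2 * ?n))"
      by (rule polygon_length_double_ge) simp
    also have "\<dots> \<le> polygon_length g x l (2 * (2 * (2 * ?n)))"
      by (rule polygon_length_double_ge) simp
    finally show ?thesis by (simp add: D_def)
  qed
  have "N * (\<delta> * l / 4) \<le> D N" for N
  proof (induction N)
    case 0
    then show ?case by (simp add: D_def polygon_length_def)
  next
    case (Suc N)
    then show ?case using step[of N] by (simp add: algebra_simps)
  qed
  moreover have "D N \<le> V" for N unfolding D_def by (rule le) simp
  moreover obtain N :: nat where "V < N * (\<delta> * l / 4)"
    using reals_Archimedean3[of "\<delta> * l / 4"] \<delta> l by auto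
  ultimately show False by (meson not_less order_trans)
qed

section \<open>Weak derivatives\<close>

lemma integrable_continuous_compact_support:
  fixes f :: "'a::euclidean_space \<Rightarrow> 'b::{banach, second_countable_topology}"
  assumes "continuous_on UNIV f" "compact K" "\<And>z. z \<notin> K \<Longrightarrow> f z = 0"
  shows "integrable lborel f"
proof -
  have "integrable lborel (\<lambda>x. indicator K x *\<^sub>R f x)"
    by (rule borel_integrable_compact) (use assms in \<open>auto intro: continuous_on_subset\<close>)
  also have "(\<lambda>x. indicator K x *\<^sub>R f x) = f"
    using assms(3) by (auto simp: indicator_def)
  finally show ?thesis .
qed

lemma bounded_continuous_compact_support:
  fixes f :: "'a::euclidean_space \<Rightarrow> 'b::real_normed_vector"
  assumes "continuous_on UNIV f" "compact K" "\<And>z. z \<notin> K \<Longrightarrow> f z = 0"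
  obtains M where "0 \<le> M" "\<And>z. norm (f z) \<le> M"
proof -
  have "compact (f ` K)"
    using assms by (intro compact_continuous_image) (auto intro: continuous_on_subset)
  then obtain M where M: "\<And>z. z \<in> K \<Longrightarrow> norm (f z) \<le> M"
    by (meson bounded_iff compact_imp_bounded imageI)
  have "norm (f z) \<le> max M 0" for z
    using M[of z] assms(3)[of z] by (cases "z \<in> K") auto
  then show ?thesis by (intro that[of "max M 0"]) auto
qed

lemma derivative_zero_outside_support:
  fixes F :: "'a::euclidean_space \<Rightarrow> 'b::real_normed_vector"
  assumes "(F has_derivative D) (at z)" "closed K" "\<And>z. z \<notin> K \<Longrightarrow> F z = 0" "z \<notin> K"
  shows "D v = 0"
proof -
  have "((\<lambda>_. 0) has_derivative D) (at z)"
    by (rule has_derivative_transform_within_open[OF assms(1), of "- K"]) (use assms in auto)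
  then have "D = (\<lambda>_. 0)" by (rule has_derivative_unique) simp
  then show ?thesis by simp
qed

lemma integral_lborel_translation:
  fixes f :: "'a::euclidean_space \<Rightarrow> 'b::{banach, second_countable_topology}"
  assumes "integrable lborel f"
  shows "integrable lborel (\<lambda>z. f (z + a))" "(\<integral>z. f (z + a) \<partial>lborel) = (\<integral>z. f z \<partial>lborel)"
proof -
  have f: "f \<in> borel_measurable borel" using borel_measurable_integrable[OF assms] by simp
  have "integrable (distr lborel borel ((+) a)) f" by (simp add: lborel_distr_plus assms)
  then show "integrable lborel (\<lambda>z. f (z + a))"
    by (subst (asm) integrable_distr_eq) (use f in \<open>auto simp: add.commute\<close>)
  have "(\<integral>z. f z \<partial>lborel) = (\<integral>z. f z \<partial>distr lborel borel ((+) a))"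
    by (simp add: lborel_distr_plus)
  also have "\<dots> = (\<integral>z. f (z + a) \<partial>lborel)"
    by (subst integral_distr) (use f in \<open>auto simp: add.commute\<close>)
  finally show "(\<integral>z. f (z + a) \<partial>lborel) = (\<integral>z. f z \<partial>lborel)" ..
qed

text \<open>The integral of a difference quotient vanishes because Lebesgue measure is invariant under
  translations.  The quotients converge boundedly to the derivative and live on a fixed ball, so
  the limit may be taken under the integral, without iterated integrals.\<close>

lemma integral_directional_derivative_eq_0:
  fixes F :: "'a::euclidean_space \<Rightarrow> 'b::euclidean_space"
  assumes der: "\<And>z. (F has_derivative F' z) (at z)"
    and cont: "continuous_on UNIV (\<lambda>z. F' z v)"
    and K: "compact K" and supp: "\<And>z. z \<notin> K \<Longrightarrow> F z = 0"
  shows "(\<integral>z. F' z v \<partial>lborel) = 0"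
proof -
  have contF: "continuous_on UNIV F"
    using der by (meson continuous_at_imp_continuous_on has_derivative_continuous)
  have supp': "F' z v = 0" if "z \<notin> K" for z
    using derivative_zero_outside_support[OF der compact_imp_closed[OF K] supp that] .
  obtain M where M: "0 \<le> M" "\<And>z. norm (F' z v) \<le> M"
    using bounded_continuous_compact_support[OF cont K supp'] by blast
  obtain R where R: "\<And>z. z \<in> K \<Longrightarrow> norm z \<le> R"
    using compact_imp_bounded[OF K] by (auto simp: bounded_iff)
  have line: "((\<lambda>t. F (z + t *\<^sub>R v)) has_vector_derivative F' (z + t *\<^sub>R v) v) (at t within S)" for z t S
  proof -
    have "((\<lambda>t. F (z + t *\<^sub>R v)) has_derivative (\<lambda>s. F' (z + t *\<^sub>R v) (s *\<^sub>R v))) (at t within S)"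
      by (rule has_derivative_compose[of "\<lambda>t. z + t *\<^sub>R v", OF _ der])
         (auto intro!: derivative_eq_intros)
    moreover have "F' (z + t *\<^sub>R v) (s *\<^sub>R v) = s *\<^sub>R F' (z + t *\<^sub>R v) v" for s
      using linear_scale[OF has_derivative_linear[OF der]] .
    ultimately show ?thesis by (simp add: has_vector_derivative_def)
  qed
  define \<tau> where "\<tau> n = inverse (real (Suc n))" for n
  have \<tau>: "0 < \<tau> n" "\<tau> n \<le> 1" for n by (auto simp: \<tau>_def inverse_le_1_iff)
  have \<tau>0: "\<tau> \<longlonglongrightarrow> 0" unfolding \<tau>_def by (rule LIMSEQ_inverse_real_of_nat)
  define q where "q n z = (1 / \<tau> n) *\<^sub>R (F (z + \<tau> n *\<^sub>R v) - F z)" for n z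
  have intF: "integrable lborel F"
    by (rule integrable_continuous_compact_support[OF contF K supp])
  have q0: "(\<integral>z. q n z \<partial>lborel) = 0" for n
    unfolding q_def by (simp add: integral_lborel_translation[OF intF] intF)
  have "(\<lambda>n. \<integral>z. q n z \<partial>lborel) \<longlonglongrightarrow> (\<integral>z. F' z v \<partial>lborel)"
  proof (rule integral_dominated_convergence)
    show "(\<lambda>z. F' z v) \<in> borel_measurable lborel"
      using borel_measurable_continuous_onI[OF cont] by simp
    show "q n \<in> borel_measurable lborel" for n
    proof -
      have "continuous_on UNIV (\<lambda>z. F (z + \<tau> n *\<^sub>R v))"
        by (rule continuous_on_compose2[OF contF]) (auto intro!: continuous_intros)
      then have "continuous_on UNIV (q n)"
        unfolding q_def by (intro continuous_intros contF)
      then show ?thesis using borel_measurable_continuous_onI by simp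
    qed
    show "integrable lborel (\<lambda>z::'a. indicator (cball 0 (R + norm v)) z *\<^sub>R M)"
      by (rule borel_integrable_compact) auto
    show "AE z in lborel. (\<lambda>n. q n z) \<longlonglongrightarrow> F' z v"
    proof (rule AE_I2)
      fix z
      have "((\<lambda>h. (1 / h) *\<^sub>R (F (z + h *\<^sub>R v) - F z)) \<longlongrightarrow> F' z v) (at 0)"
      proof (rule LIM_zero_cancel, rule tendsto_norm_zero_cancel)
        have "((\<lambda>h. norm (F (z + h *\<^sub>R v) - F z - h *\<^sub>R F' z v) / norm h) \<longlongrightarrow> 0) (at 0)"
          using line[of z 0 UNIV] by (simp add: has_vector_derivative_def has_derivative_at)
        moreover have "\<forall>\<^sub>F h in at 0. norm (F (z + h *\<^sub>R v) - F z - h *\<^sub>R F' z v) / norm h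
            = norm ((1 / h) *\<^sub>R (F (z + h *\<^sub>R v) - F z) - F' z v)"
        proof (rule eventually_at_ball'[THEN eventually_mono, of 1])
          fix h :: real assume "h \<in> ball 0 1 \<and> h \<noteq> 0 \<and> h \<in> UNIV"
          then have "(1 / h) *\<^sub>R (F (z + h *\<^sub>R v) - F z) - F' z v
              = (1 / h) *\<^sub>R (F (z + h *\<^sub>R v) - F z - h *\<^sub>R F' z v)"
            by (simp add: scaleR_diff_right)
          then show "norm (F (z + h *\<^sub>R v) - F z - h *\<^sub>R F' z v) / norm h
            = norm ((1 / h) *\<^sub>R (F (z + h *\<^sub>R v) - F z) - F' z v)"
            by simp
        qed simp
        ultimately show "((\<lambda>h. norm ((1 / h) *\<^sub>R (F (z + h *\<^sub>R v) - F z) - F' z v)) \<longlongrightarrow> 0) (at 0)"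
          by (rule Lim_transform_eventually)
      qed
      then show "(\<lambda>n. q n z) \<longlonglongrightarrow> F' z v"
        unfolding q_def
        by (rule filterlim_compose[where f=\<tau>])
           (use \<tau> \<tau>0 in \<open>auto simp: filterlim_at less_imp_neq[symmetric]\<close>)
    qed
    show "AE z in lborel. norm (q n z) \<le> indicator (cball 0 (R + norm v)) z *\<^sub>R M" for n
    proof (rule AE_I2)
      fix z
      show "norm (q n z) \<le> indicator (cball 0 (R + norm v)) z *\<^sub>R M"
      proof (cases "norm z \<le> R + norm v")
        case True
        have "norm (F (z + \<tau> n *\<^sub>R v) - F (z + 0 *\<^sub>R v)) \<le> M * norm (\<tau> n - 0)"
        proof (rule differentiable_bound[of UNIV])
          fix t :: real
          show "((\<lambda>t. F (z + t *\<^sub>R v)) has_derivative (\<lambda>s. s *\<^sub>R F' (z + t *\<^sub>R v) v)) (at t within UNIV)"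
            using line by (simp add: has_vector_derivative_def)
          show "onorm (\<lambda>s. s *\<^sub>R F' (z + t *\<^sub>R v) v) \<le> M"
            by (rule onorm_le) (use M(2) in \<open>simp add: mult.commute[of M] mult_left_mono\<close>)
        qed auto
        then have "norm (q n z) \<le> M"
          using \<tau>(1)[of n] unfolding q_def norm_scaleR by (simp add: field_simps del: scaleR_diff_right)
        then show ?thesis using True by simp
      next
        case False
        have "norm (\<tau> n *\<^sub>R v) \<le> norm v"
          using \<tau>[of n] by (simp add: mult_left_le_one_le)
        then have "z \<notin> K" "z + \<tau> n *\<^sub>R v \<notin> K"
          using False R[of z] R[of "z + \<tau> n *\<^sub>R v"] norm_diff_ineq[of z "\<tau> n *\<^sub>R v"]
            norm_ge_zero[of v] by auto
        then show ?thesis using M(1) by (simp add: q_def supp)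
      qed
    qed
  qed
  then show ?thesis unfolding q0 by (simp add: LIMSEQ_const_iff)
qed

lemma test_fun_obtain:
  assumes "test_fun \<phi>"
  obtains \<phi>x \<phi>y K where
    "\<And>z. (\<phi> has_derivative (\<lambda>h. Re h * \<phi>x z + Im h * \<phi>y z)) (at z)"
    "continuous_on UNIV \<phi>" "continuous_on UNIV \<phi>x" "continuous_on UNIV \<phi>y"
    "compact K" "\<And>z. z \<notin> K \<Longrightarrow> \<phi> z = 0" "\<And>z. z \<notin> K \<Longrightarrow> \<phi>x z = 0" "\<And>z. z \<notin> K \<Longrightarrow> \<phi>y z = 0"
proof -
  have "Ck_plane (Suc 0) \<phi>" and c: "Ck_plane 0 \<phi>" using assms by (auto simp: test_fun_def simp del: Ck_plane.simps)
  then obtain \<phi>x \<phi>y where d: "\<And>z. (\<phi> has_derivative (\<lambda>h. Re h * \<phi>x z + Im h * \<phi>y z)) (at z)"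
    and c': "continuous_on UNIV \<phi>x" "continuous_on UNIV \<phi>y"
    by auto
  define K where "K = closure (support_on UNIV \<phi>)"
  have K: "compact K" using assms by (simp add: K_def test_fun_def)
  have s: "\<phi> z = 0" if "z \<notin> K" for z
    using that closure_subset[of "support_on UNIV \<phi>"] by (auto simp: K_def support_on_def)
  have "\<phi>x z = 0" "\<phi>y z = 0" if "z \<notin> K" for z
    using derivative_zero_outside_support[OF d compact_imp_closed[OF K] s that, of 1]
      derivative_zero_outside_support[OF d compact_imp_closed[OF K] s that, of \<i>] by auto
  with d c c' K s show ?thesis by (intro that[of \<phi>x \<phi>y K]) auto
qed

lemma set_integrable_continuous_compact:
  fixes f :: "'a::euclidean_space \<Rightarrow> 'b::{banach, second_countable_topology}"
  assumes "continuous_on UNIV f" "compact K"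
  shows "set_integrable lebesgue K f"
proof -
  have "integrable lborel (\<lambda>x. indicator K x *\<^sub>R f x)"
    by (rule borel_integrable_compact) (use assms in \<open>auto intro: continuous_on_subset\<close>)
  then show ?thesis
    unfolding set_integrable_def by (subst integrable_completion) auto
qed

lemma L1loc_continuous:
  assumes "continuous_on UNIV f"
  shows "L1loc f"
  using borel_measurable_continuous_onI[OF assms] set_integrable_continuous_compact[OF assms]
  by (auto simp: L1loc_def intro: measurable_completion)

text \<open>Integration by parts: the product of \<open>\<phi>\<close> and \<open>F\<close> has compact support, so its directional
  derivative integrates to zero.\<close>

lemma weak_derivative_C1:
  assumes der: "\<And>z. (F has_derivative (\<lambda>h. Re h *\<^sub>R Fx z + Im h *\<^sub>R Fy z)) (at z)"
    and cont: "continuous_on UNIV Fx" "continuous_on UNIV Fy"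
  shows "weak_derivative v F (\<lambda>z. Re v *\<^sub>R Fx z + Im v *\<^sub>R Fy z)"
  unfolding weak_derivative_def
proof (intro conjI allI impI)
  have contF: "continuous_on UNIV F"
    using der by (meson continuous_at_imp_continuous_on has_derivative_continuous)
  then show "L1loc F" by (rule L1loc_continuous)
  let ?G = "\<lambda>z. Re v *\<^sub>R Fx z + Im v *\<^sub>R Fy z"
  have contG: "continuous_on UNIV ?G" by (intro continuous_intros cont)
  then show "L1loc ?G" by (rule L1loc_continuous)
  fix \<phi> assume "test_fun \<phi>"
  then obtain \<phi>x \<phi>y K where \<phi>: "\<And>z. (\<phi> has_derivative (\<lambda>h. Re h * \<phi>x z + Im h * \<phi>y z)) (at z)"
    and c\<phi>: "continuous_on UNIV \<phi>" "continuous_on UNIV \<phi>x" "continuous_on UNIV \<phi>y"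
    and K: "compact K" and s: "\<And>z. z \<notin> K \<Longrightarrow> \<phi> z = 0" "\<And>z. z \<notin> K \<Longrightarrow> \<phi>x z = 0" "\<And>z. z \<notin> K \<Longrightarrow> \<phi>y z = 0"
    by (rule test_fun_obtain) blast
  let ?d = "\<lambda>z. Re v * \<phi>x z + Im v * \<phi>y z"
  have fd: "frechet_derivative \<phi> (at z) v = ?d z" for z
    using frechet_derivative_at[OF \<phi>[of z]] by metis
  have c1: "continuous_on UNIV (\<lambda>z. ?d z *\<^sub>R F z)" and c2: "continuous_on UNIV (\<lambda>z. \<phi> z *\<^sub>R ?G z)"
    by (intro continuous_intros contF contG c\<phi> cont)+
  have i: "integrable lborel (\<lambda>z. ?d z *\<^sub>R F z)" "integrable lborel (\<lambda>z. \<phi> z *\<^sub>R ?G z)"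
    by (rule integrable_continuous_compact_support[OF c1 K]; simp add: s)
       (rule integrable_continuous_compact_support[OF c2 K]; simp add: s)
  have "(\<integral>z. \<phi> z *\<^sub>R ?G z + ?d z *\<^sub>R F z \<partial>lborel) = 0"
  proof (rule integral_directional_derivative_eq_0[where F="\<lambda>z. \<phi> z *\<^sub>R F z" and K=K and v=v and
      F'="\<lambda>z h. \<phi> z *\<^sub>R (Re h *\<^sub>R Fx z + Im h *\<^sub>R Fy z) + (Re h * \<phi>x z + Im h * \<phi>y z) *\<^sub>R F z"])
    show "((\<lambda>z. \<phi> z *\<^sub>R F z) has_derivative
        (\<lambda>h. \<phi> z *\<^sub>R (Re h *\<^sub>R Fx z + Im h *\<^sub>R Fy z) + (Re h * \<phi>x z + Im h * \<phi>y z) *\<^sub>R F z)) (at z)" for z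
      by (rule has_derivative_scaleR[OF \<phi> der])
    show "continuous_on UNIV (\<lambda>z. \<phi> z *\<^sub>R ?G z + ?d z *\<^sub>R F z)"
      by (intro continuous_on_add c1 c2)
  qed (use K s in auto)
  then have "(\<integral>z. ?d z *\<^sub>R F z \<partial>lborel) = - (\<integral>z. \<phi> z *\<^sub>R ?G z \<partial>lborel)"
    using i by (simp add: eq_neg_iff_add_eq_0 add.commute)
  then show "(\<integral>z. frechet_derivative \<phi> (at z) v *\<^sub>R F z \<partial>lebesgue) = - (\<integral>z. \<phi> z *\<^sub>R ?G z \<partial>lebesgue)"
    unfolding fd using borel_measurable_integrable[OF i(1)] borel_measurable_integrable[OF i(2)]
    by (simp add: integral_completion)
qed

text \<open>Weak derivatives survive dominated convergence almost everywhere.  Local integrability of the common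
  bound \<open>b\<close> suffices, because test functions and their derivatives are bounded with compact
  support.\<close>

lemma weak_derivative_limit:
  assumes wd: "\<And>n. weak_derivative v (F n) (G n)"
    and mF: "f \<in> borel_measurable lebesgue" and mG: "g \<in> borel_measurable lebesgue"
    and limF: "AE z in lebesgue. (\<lambda>n. F n z) \<longlonglongrightarrow> f z"
    and limG: "AE z in lebesgue. (\<lambda>n. G n z) \<longlonglongrightarrow> g z"
    and bF: "\<And>n. AE z in lebesgue. norm (F n z) \<le> b z"
    and bG: "\<And>n. AE z in lebesgue. norm (G n z) \<le> b z"
    and b: "\<And>K. compact K \<Longrightarrow> set_integrable lebesgue K (b :: complex \<Rightarrow> real)"
  shows "weak_derivative v f g"
proof -
  have mFn: "F n \<in> borel_measurable lebesgue" "G n \<in> borel_measurable lebesgue" for n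
    using wd by (auto simp: weak_derivative_def L1loc_def)
  (* passage to the limit against a bounded multiplier with compact support *)
  have pass: "(\<lambda>n. \<integral>z. c z *\<^sub>R H n z \<partial>lebesgue) \<longlonglongrightarrow> (\<integral>z. c z *\<^sub>R h z \<partial>lebesgue)"
    and int: "integrable lebesgue (\<lambda>z. c z *\<^sub>R h z)"
    if c: "c \<in> borel_measurable lebesgue" "\<And>z. \<bar>c z\<bar> \<le> M * indicator K z" and K: "compact K"
      and Hm: "\<And>n. H n \<in> borel_measurable lebesgue" and hm: "h \<in> borel_measurable lebesgue"
      and Hlim: "AE z in lebesgue. (\<lambda>n. H n z) \<longlonglongrightarrow> h z"
      and Hb: "\<And>n. AE z in lebesgue. norm (H n z) \<le> b z"
    for c :: "complex \<Rightarrow> real" and M K and H :: "nat \<Rightarrow> complex \<Rightarrow> complex" and h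
  proof -
    have 1: "(\<lambda>z. c z *\<^sub>R h z) \<in> borel_measurable lebesgue"
      "(\<lambda>z. c z *\<^sub>R H n z) \<in> borel_measurable lebesgue" for n
      using c(1) Hm hm by measurable
    have 2: "integrable lebesgue (\<lambda>z. M * (indicator K z * b z))"
      using b[OF K] by (simp add: set_integrable_def)
    have 3: "AE z in lebesgue. (\<lambda>n. c z *\<^sub>R H n z) \<longlonglongrightarrow> c z *\<^sub>R h z"
      using Hlim by eventually_elim (intro tendsto_intros)
    have 4: "AE z in lebesgue. norm (c z *\<^sub>R H n z) \<le> M * (indicator K z * b z)" for n
      using Hb[of n]
    proof eventually_elim
      case (elim z)
      have "\<bar>c z\<bar> * norm (H n z) \<le> (M * indicator K z) * b z"
        using elim c(2)[of z] abs_ge_zero[of "c z"] by (intro mult_mono) (auto intro: order_trans)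
      then show ?case by (simp add: mult.assoc)
    qed
    show "(\<lambda>n. \<integral>z. c z *\<^sub>R H n z \<partial>lebesgue) \<longlonglongrightarrow> (\<integral>z. c z *\<^sub>R h z \<partial>lebesgue)"
      by (rule integral_dominated_convergence[OF 1 2 3 4])
    show "integrable lebesgue (\<lambda>z. c z *\<^sub>R h z)"
      by (rule integrable_dominated_convergence[OF 1 2 3 4])
  qed
  have L1: "L1loc h" if "\<And>n. H n \<in> borel_measurable lebesgue" "h \<in> borel_measurable lebesgue"
      "AE z in lebesgue. (\<lambda>n. H n z) \<longlonglongrightarrow> h z" "\<And>n. AE z in lebesgue. norm (H n z) \<le> b z"
    for H :: "nat \<Rightarrow> complex \<Rightarrow> complex" and h
    unfolding L1loc_def set_integrable_def
  proof (intro conjI allI impI)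
    fix K :: "complex set" assume K: "compact K"
    then have "K \<in> sets lborel" by (simp add: borel_compact)
    then have "K \<in> sets lebesgue" by (rule sets_completionI_sets)
    then show "integrable lebesgue (\<lambda>x. indicat_real K x *\<^sub>R h x)"
      by (intro int[of "indicat_real K" 1 K, OF _ _ K that]) auto
  qed (fact that)
  show ?thesis
    unfolding weak_derivative_def
  proof (intro conjI allI impI)
    show "L1loc f" by (rule L1[OF mFn(1) mF limF bF])
    show "L1loc g" by (rule L1[OF mFn(2) mG limG bG])
    fix \<phi> assume t: "test_fun \<phi>"
    then obtain \<phi>x \<phi>y K where \<phi>: "\<And>z. (\<phi> has_derivative (\<lambda>h. Re h * \<phi>x z + Im h * \<phi>y z)) (at z)"
      and c\<phi>: "continuous_on UNIV \<phi>" "continuous_on UNIV \<phi>x" "continuous_on UNIV \<phi>y"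
      and K: "compact K" and s: "\<And>z. z \<notin> K \<Longrightarrow> \<phi> z = 0" "\<And>z. z \<notin> K \<Longrightarrow> \<phi>x z = 0" "\<And>z. z \<notin> K \<Longrightarrow> \<phi>y z = 0"
      by (rule test_fun_obtain) blast
    let ?d = "\<lambda>z. Re v * \<phi>x z + Im v * \<phi>y z"
    have fd: "frechet_derivative \<phi> (at z) v = ?d z" for z
      using frechet_derivative_at[OF \<phi>[of z]] by metis
    have cd: "continuous_on UNIV ?d" by (intro continuous_intros c\<phi>)
    have sd: "?d z = 0" if "z \<notin> K" for z using s that by simp
    obtain M1 where M1: "\<And>z. norm (?d z) \<le> M1"
      using bounded_continuous_compact_support[OF cd K sd] by blast
    obtain M2 where M2: "\<And>z. norm (\<phi> z) \<le> M2"
      using bounded_continuous_compact_support[OF c\<phi>(1) K s(1)] by blast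
    have m: "?d \<in> borel_measurable lebesgue" "\<phi> \<in> borel_measurable lebesgue"
      using borel_measurable_continuous_onI[OF cd] borel_measurable_continuous_onI[OF c\<phi>(1)]
      by (auto intro: measurable_completion)
    have "\<bar>?d z\<bar> \<le> M1 * indicator K z" for z
      using M1[of z] sd[of z] by (auto simp: indicator_def)
    from pass[OF m(1) this K mFn(1) mF limF bF]
    have A: "(\<lambda>n. \<integral>z. ?d z *\<^sub>R F n z \<partial>lebesgue) \<longlonglongrightarrow> (\<integral>z. ?d z *\<^sub>R f z \<partial>lebesgue)" .
    have "\<bar>\<phi> z\<bar> \<le> M2 * indicator K z" for z
      using M2[of z] s(1)[of z] by (auto simp: indicator_def)
    from pass[OF m(2) this K mFn(2) mG limG bG]
    have B: "(\<lambda>n. - (\<integral>z. \<phi> z *\<^sub>R G n z \<partial>lebesgue)) \<longlonglongrightarrow> - (\<integral>z. \<phi> z *\<^sub>R g z \<partial>lebesgue)"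
      by (rule tendsto_minus)
    have "(\<integral>z. ?d z *\<^sub>R F n z \<partial>lebesgue) = - (\<integral>z. \<phi> z *\<^sub>R G n z \<partial>lebesgue)" for n
      using wd[of n] t unfolding weak_derivative_def fd[symmetric] by blast
    then show "(\<integral>z. frechet_derivative \<phi> (at z) v *\<^sub>R f z \<partial>lebesgue) = - (\<integral>z. \<phi> z *\<^sub>R g z \<partial>lebesgue)"
      unfolding fd using LIMSEQ_unique[OF A] B by simp
  qed
qed

lemma L2loc_bounded_by:
  assumes m: "f \<in> borel_measurable lebesgue"
    and b: "AE z in lebesgue. (norm (f z))\<^sup>2 \<le> b z"
    and i: "\<And>K. compact K \<Longrightarrow> set_integrable lebesgue K b"
  shows "L2loc f"
  unfolding L2loc_def
proof (intro conjI allI impI m)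
  fix K :: "complex set" assume K: "compact K"
  then have "K \<in> sets lborel" by (simp add: borel_compact)
  then have Ks: "K \<in> sets lebesgue" by (rule sets_completionI_sets)
  from i[OF K] show "set_integrable lebesgue K (\<lambda>z. (norm (f z))\<^sup>2)"
    unfolding set_integrable_def
  proof (rule Bochner_Integration.integrable_bound)
    show "(\<lambda>z. indicat_real K z *\<^sub>R (norm (f z))\<^sup>2) \<in> borel_measurable lebesgue"
      using m Ks by measurable
    show "AE z in lebesgue. norm (indicat_real K z *\<^sub>R (norm (f z))\<^sup>2) \<le> norm (indicat_real K z *\<^sub>R b z)"
      using b by eventually_elim (auto simp: indicator_def)
  qed
qed

section \<open>Local integrability of powers of the distance to the real line\<close>

lemma integrable_abs_powr_interval:
  fixes R s :: real
  assumes s: "s < 1" and R: "0 \<le> R"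
  shows "integrable lborel (\<lambda>y. indicator {-R..R} y * \<bar>y\<bar> powr (- s))"
proof -
  define g where "g y = indicator {0..R} y * y powr (- s)" for y :: real
  have "(\<lambda>y. y powr (- s)) integrable_on {0..R}"
    by (rule integrable_on_powr_from_0) (use s R in auto)
  then have "(\<lambda>y. y powr (- s)) absolutely_integrable_on {0..R}"
    by (subst absolutely_integrable_on_iff_nonneg) auto
  then have g: "integrable lborel g"
    unfolding set_integrable_def g_def by (subst (asm) integrable_completion) (auto simp: g_def)
  then have "integrable lborel (\<lambda>y. g (0 + (-1) * y))"
    by (rule lborel_integrable_real_affine) simp
  with g have "integrable lborel (\<lambda>y. g y + g (- y))" by simp
  then show ?thesis
    by (rule Bochner_Integration.integrable_bound) (auto simp: g_def indicator_def)
qed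

text \<open>The square \<open>[-R, R]\<^sup>2\<close> contains \<open>K\<close> for large \<open>R\<close>, and on it the integral splits into a product of
  one-dimensional ones.\<close>

lemma set_integrable_abs_Im_powr:
  assumes s: "s < 1" and K: "compact K"
  shows "set_integrable lebesgue K (\<lambda>z. \<bar>Im z\<bar> powr (- s))"
proof -
  obtain R where R: "0 < R" "\<And>z. z \<in> K \<Longrightarrow> cmod z \<le> R"
    using compact_imp_bounded[OF K] by (auto simp: bounded_pos)
  \<comment> \<open>One factor for each basis vector; the singular one belongs to the imaginary axis.\<close>
  define f where "f b y = (if b = \<i> then indicator {-R..R} y * \<bar>y\<bar> powr (- s) else indicator {-R..R} y)"
    for b :: complex and y :: real
  have m: "f b \<in> borel_measurable borel" for b unfolding f_def by measurable
  have nn: "0 \<le> f b y" for b y by (simp add: f_def)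
  have i: "integrable lborel (f b)" for b
    using integrable_abs_powr_interval[OF s, of R] R(1)
    by (cases "b = \<i>") (auto simp: f_def[abs_def])
  have "(\<integral>\<^sup>+z. (\<Prod>b\<in>Basis. ennreal (f b (z \<bullet> b))) \<partial>lborel) = (\<Prod>b\<in>Basis. (\<integral>\<^sup>+y. f b y \<partial>lborel))"
    by (rule nn_integral_lborel_prod) (use m in auto)
  also have "\<dots> < \<infinity>"
  proof -
    have "(\<integral>\<^sup>+y. f b y \<partial>lborel) < \<infinity>" for b
      using i[of b] nn by (simp add: integrable_iff_bounded)
    then show ?thesis by (simp add: Basis_complex_def ennreal_mult_less_top)
  qed
  finally have fin: "(\<integral>\<^sup>+z. (\<Prod>b\<in>Basis. ennreal (f b (z \<bullet> b))) \<partial>lborel) < \<infinity>" .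
  have "integrable lborel (\<lambda>z. f 1 (Re z) * f \<i> (Im z))"
  proof (rule integrableI_bounded)
    show "(\<lambda>z. f 1 (Re z) * f \<i> (Im z)) \<in> borel_measurable lborel"
      using m by measurable
    have "ennreal (norm (f 1 (Re z) * f \<i> (Im z))) = (\<Prod>b\<in>Basis. ennreal (f b (z \<bullet> b)))" for z
      using nn by (simp add: Basis_complex_def ennreal_mult abs_mult)
    then show "(\<integral>\<^sup>+z. ennreal (norm (f 1 (Re z) * f \<i> (Im z))) \<partial>lborel) < \<infinity>" using fin by simp
  qed
  then have "integrable lborel (\<lambda>z. indicator K z *\<^sub>R \<bar>Im z\<bar> powr (- s))"
  proof (rule Bochner_Integration.integrable_bound)
    show "(\<lambda>z. indicat_real K z *\<^sub>R \<bar>Im z\<bar> powr (- s)) \<in> borel_measurable lborel"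
      using borel_compact[OF K] by measurable
    show "AE z in lborel. norm (indicat_real K z *\<^sub>R \<bar>Im z\<bar> powr (- s)) \<le> norm (f 1 (Re z) * f \<i> (Im z))"
    proof (rule AE_I2)
      fix z
      show "norm (indicat_real K z *\<^sub>R \<bar>Im z\<bar> powr (- s)) \<le> norm (f 1 (Re z) * f \<i> (Im z))"
      proof (cases "z \<in> K")
        case True
        then have "\<bar>Re z\<bar> \<le> R" "\<bar>Im z\<bar> \<le> R"
          using R(2)[OF True] abs_Re_le_cmod[of z] abs_Im_le_cmod[of z] by auto
        then have "Re z \<in> {-R..R}" "Im z \<in> {-R..R}" by auto
        moreover have "(1::complex) \<noteq> \<i>" by (simp add: complex_eq_iff)
        ultimately show ?thesis using True by (simp add: f_def)
      qed simp
    qed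
  qed
  then show ?thesis
    unfolding set_integrable_def using borel_compact[OF K] by (subst integrable_completion) auto
qed

lemma AE_Im_neq_0: "AE z in lebesgue. Im z \<noteq> 0"
proof -
  have "negligible {z::complex. z \<bullet> \<i> = 0}"
    by (rule negligible_standard_hyperplane) (simp add: Basis_complex_def)
  then have "{z::complex. Im z = 0} \<in> null_sets lebesgue"
    by (simp add: negligible_iff_null_sets)
  from AE_not_in[OF this] show ?thesis by simp
qed

section \<open>Strongly monotone maps\<close>

text \<open>By Cauchy--Schwarz, strong monotonicity gives \<open>|f z - f w| \<ge> c |z - w|\<close>.  Hence \<open>f\<close> is injective and
  its range is complete; by invariance of domain the range is also open.\<close>

lemma strongly_monotone_homeomorphism:
  fixes f :: "'a::euclidean_space \<Rightarrow> 'a"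
  assumes c: "0 < c" and mono: "\<And>z w. c * (norm (z - w))\<^sup>2 \<le> (f z - f w) \<bullet> (z - w)"
    and cont: "continuous_on UNIV f"
  shows "\<exists>g. homeomorphism UNIV UNIV f g"
proof -
  have expand: "c * norm (z - w) \<le> norm (f z - f w)" for z w
  proof (cases "z = w")
    case False
    have "(c * norm (z - w)) * norm (z - w) \<le> norm (f z - f w) * norm (z - w)"
      using mono[of z w] norm_cauchy_schwarz[of "f z - f w" "z - w"]
      by (simp add: power2_eq_square)
    then show ?thesis using False by (simp add: mult_le_cancel_right)
  qed simp
  have inj: "inj f"
  proof (rule injI)
    fix z w assume "f z = f w"
    then have "norm (z - w) \<le> 0" using expand[of z w] c by (simp add: mult_le_0_iff)
    then show "z = w" by simp
  qed
  have op: "open (range f)" by (rule invariance_of_domain[OF cont open_UNIV inj])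
  have "complete (range f)"
    unfolding complete_def
  proof (intro allI impI, elim conjE)
    fix y assume y: "\<forall>n. y n \<in> range f" and C: "Cauchy y"
    then have "\<forall>n. \<exists>t. y n = f t" by blast
    then obtain x where x: "\<And>n. y n = f (x n)" by metis
    have "Cauchy x"
      unfolding Cauchy_def
    proof (intro allI impI)
      fix e :: real assume e: "0 < e"
      then obtain M where M: "\<And>m n. m \<ge> M \<Longrightarrow> n \<ge> M \<Longrightarrow> dist (y m) (y n) < c * e"
        using metric_CauchyD[OF C mult_pos_pos[OF c e]] by blast
      have "dist (x m) (x n) < e" if "m \<ge> M" "n \<ge> M" for m n
      proof -
        have "c * dist (x m) (x n) < c * e"
          using expand[of "x m" "x n"] M[OF that] by (simp add: dist_norm x)
        then show ?thesis using c by simp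
      qed
      then show "\<exists>M. \<forall>m\<ge>M. \<forall>n\<ge>M. dist (x m) (x n) < e" by blast
    qed
    then obtain l where "x \<longlonglongrightarrow> l" unfolding Cauchy_convergent_iff convergent_def ..
    then have "(\<lambda>n. f (x n)) \<longlonglongrightarrow> f l"
      by (intro continuous_on_tendsto_compose[OF cont]) auto
    moreover have "y = (\<lambda>n. f (x n))" using x by (rule ext)
    ultimately have "y \<longlonglongrightarrow> f l" by simp
    then show "\<exists>l\<in>range f. y \<longlonglongrightarrow> l" by blast
  qed
  then have "closed (range f)" by (rule complete_imp_closed)
  with op have "range f = UNIV" using clopen[of "range f"] by auto
  moreover obtain g where "homeomorphism UNIV (range f) f g"
    using invariance_of_domain_homeomorphism[OF open_UNIV cont _ inj] by auto
  ultimately show ?thesis by auto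
qed

text \<open>In the form \<open>h \<mapsto> p h + q cnj h\<close> the quadratic form of the differential is
  \<open>Re p |h|\<^sup>2 + Re (q (cnj h)\<^sup>2)\<close>; the imaginary part of \<open>p\<close> acts by an infinitesimal rotation and
  drops out.\<close>

lemma inner_real_differential:
  "(Re h *\<^sub>R a + Im h *\<^sub>R b) \<bullet> h \<ge> (Re ((a - \<i> * b) / 2) - norm ((a + \<i> * b) / 2)) * (norm h)\<^sup>2"
proof -
  define p q where "p = (a - \<i> * b) / 2" and "q = (a + \<i> * b) / 2"
  have "Re h *\<^sub>R a + Im h *\<^sub>R b = p * h + q * cnj h"
    by (simp add: p_def q_def complex_eq_iff field_simps)
  then have "(Re h *\<^sub>R a + Im h *\<^sub>R b) \<bullet> h = Re p * (norm h)\<^sup>2 + Re (q * (cnj h)\<^sup>2)"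
    unfolding cmod_power2 by (simp add: inner_complex_def power2_eq_square algebra_simps)
  moreover have "- (norm q * (norm h)\<^sup>2) \<le> Re (q * (cnj h)\<^sup>2)"
    using abs_Re_le_cmod[of "q * (cnj h)\<^sup>2"] by (simp add: norm_mult norm_power)
  ultimately show ?thesis by (simp add: p_def[symmetric] q_def[symmetric] left_diff_distrib)
qed

lemma strongly_monotone_if_wirtinger:
  fixes f fx fy :: "complex \<Rightarrow> complex"
  assumes der: "\<And>z. (f has_derivative (\<lambda>h. Re h *\<^sub>R fx z + Im h *\<^sub>R fy z)) (at z)"
    and bound: "\<And>z. c \<le> Re (wirtinger_z fx fy z) - norm (wirtinger_zbar fx fy z)"
  shows "c * (norm (z - w))\<^sup>2 \<le> (f z - f w) \<bullet> (z - w)"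
proof -
  define h where "h = z - w"
  define \<phi> where "\<phi> t = f (w + t *\<^sub>R h) \<bullet> h - c * (norm h)\<^sup>2 * t" for t
  have d: "(\<phi> has_real_derivative
      ((Re h *\<^sub>R fx (w + t *\<^sub>R h) + Im h *\<^sub>R fy (w + t *\<^sub>R h)) \<bullet> h - c * (norm h)\<^sup>2)) (at t)" for t
  proof -
    have 1: "((\<lambda>t. f (w + t *\<^sub>R h)) has_derivative
        (\<lambda>s. Re (s *\<^sub>R h) *\<^sub>R fx (w + t *\<^sub>R h) + Im (s *\<^sub>R h) *\<^sub>R fy (w + t *\<^sub>R h))) (at t)"
      by (rule has_derivative_compose[of "\<lambda>t. w + t *\<^sub>R h", OF _ der])
         (auto intro!: derivative_eq_intros)
    have 2: "((\<lambda>t. f (w + t *\<^sub>R h) \<bullet> h - c * (norm h)\<^sup>2 * t) has_derivative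
        (\<lambda>s. (Re (s *\<^sub>R h) *\<^sub>R fx (w + t *\<^sub>R h) + Im (s *\<^sub>R h) *\<^sub>R fy (w + t *\<^sub>R h)) \<bullet> h
            - c * (norm h)\<^sup>2 * s)) (at t)"
      by (intro has_derivative_diff has_derivative_inner_left 1 has_derivative_mult_right has_derivative_ident)
    show ?thesis
      unfolding has_field_derivative_def \<phi>_def
      by (rule has_derivative_eq_rhs[OF 2]) (simp add: fun_eq_iff inner_add_left algebra_simps)
  qed
  have "\<phi> 0 \<le> \<phi> 1"
  proof (rule DERIV_nonneg_imp_nondecreasing[of 0 1 \<phi>])
    fix t :: real
    let ?p = "w + t *\<^sub>R h"
    have "c * (norm h)\<^sup>2 \<le> (Re (wirtinger_z fx fy ?p) - norm (wirtinger_zbar fx fy ?p)) * (norm h)\<^sup>2"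
      using bound by (rule mult_right_mono) simp
    also have "\<dots> \<le> (Re h *\<^sub>R fx ?p + Im h *\<^sub>R fy ?p) \<bullet> h"
      using inner_real_differential unfolding wirtinger_z_def wirtinger_zbar_def .
    finally show "\<exists>y. (\<phi> has_real_derivative y) (at t) \<and> 0 \<le> y"
      using d[of t] by (intro exI[of _ "(Re h *\<^sub>R fx ?p + Im h *\<^sub>R fy ?p) \<bullet> h - c * (norm h)\<^sup>2"]) simp
  qed simp
  then show ?thesis by (simp add: \<phi>_def h_def inner_diff_left)
qed

section \<open>The profile of one wave\<close>

text \<open>The rate at which the symmetric gradient of the profile dies out, both towards the real axis and
  towards infinity.\<close>

definition decay :: "real \<Rightarrow> real" where
  "decay t = \<bar>t\<bar> / (1 + t\<^sup>2)"

lemma decay_nonneg: "0 \<le> decay t"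
  by (simp add: decay_def)

text \<open>With \<open>G t = t / (1 + t)\<close> the right-hand side is \<open>2 (G (8 t) - G t)\<close>.  Summed over \<open>t, 8 t, 64 t, \<dots>\<close> it
  telescopes, and \<open>G\<close> takes values in \<open>[0, 1)\<close>: this is how the bound in \<open>sum_decay_le\<close>
  becomes independent of both the point and the number of terms.\<close>

lemma decay_le_telescope:
  assumes t: "0 \<le> t"
  shows "decay t \<le> 2 * (8 * t / (1 + 8 * t) - t / (1 + t))"
proof -
  have "(1 + 8 * t) * (1 + t) \<le> 14 * (1 + t\<^sup>2)"
  proof -
    have eq: "(1 + 8 * t) * (1 + t) = 1 + 9 * t + 8 * t\<^sup>2" by (simp add: power2_eq_square algebra_simps)
    have "0 \<le> t\<^sup>2 - 2 * t + 1"
      using zero_le_power2[of "t - 1"] by (simp add: power2_eq_square algebra_simps)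
    moreover have "0 \<le> t\<^sup>2" by simp
    moreover have "14 * (1 + t\<^sup>2) = 14 + 14 * t\<^sup>2" by simp
    ultimately show ?thesis unfolding eq by argo
  qed
  then have num: "t * ((1 + 8 * t) * (1 + t)) \<le> t * (14 * (1 + t\<^sup>2))"
    using t by (rule mult_left_mono)
  have "t / (1 + t\<^sup>2) \<le> 14 * t / ((1 + 8 * t) * (1 + t))"
  proof -
    have p: "0 < 1 + t\<^sup>2" "0 < (1 + 8 * t) * (1 + t)" using t by (auto intro!: add_pos_nonneg mult_pos_pos)
    show ?thesis
      unfolding pos_divide_le_eq[OF p(1)] times_divide_eq_left pos_le_divide_eq[OF p(2)]
      using num by (simp only: mult_ac)
  qed
  also have "14 * t / ((1 + 8 * t) * (1 + t)) = 2 * (8 * t / (1 + 8 * t) - t / (1 + t))"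
    using t by (simp add: divide_simps add_nonneg_eq_0_iff) (simp add: algebra_simps)
  finally show ?thesis using t by (simp add: decay_def)
qed

lemma sum_decay_le:
  "(\<Sum>j<n. decay (8 ^ j * t)) \<le> 2"
proof -
  define s where "s = \<bar>t\<bar>"
  define G where "G j = 8 ^ j * s / (1 + 8 ^ j * s)" for j :: nat
  have s: "0 \<le> s" by (simp add: s_def)
  have "(\<Sum>j<n. decay (8 ^ j * t)) = (\<Sum>j<n. decay (8 ^ j * s))"
    by (simp add: decay_def s_def abs_mult power_mult_distrib)
  also have "\<dots> \<le> (\<Sum>j<n. 2 * (G (Suc j) - G j))"
  proof (rule sum_mono)
    fix j
    show "decay (8 ^ j * s) \<le> 2 * (G (Suc j) - G j)"
      using decay_le_telescope[of "8 ^ j * s"] s by (simp add: G_def mult.assoc)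
  qed
  also have "\<dots> = 2 * (G n - G 0)"
    by (simp only: sum_distrib_left[symmetric] sum_lessThan_telescope)
  also have "\<dots> \<le> 2"
  proof -
    have "G n \<le> 1" "0 \<le> G 0" using s by (auto simp: G_def divide_le_eq add_pos_nonneg)
    then show ?thesis by simp
  qed
  finally show ?thesis .
qed

text \<open>The exponent \<open>-1/3\<close> serves two purposes.  It is negative, so that the bounds at the points \<open>8\<^sup>j t\<close>
  form a geometric series, whose ratio is \<open>8 powr (-1/3) = 1/2\<close>; and it is larger than \<open>-1/2\<close>,
  so that the square of the bound is still locally integrable.\<close>

lemma decay_le_powr:
  assumes "t \<noteq> 0"
  shows "1 / (1 + t\<^sup>2) \<le> \<bar>t\<bar> powr (- (1/3))" "decay t \<le> \<bar>t\<bar> powr (- (1/3))"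
proof -
  define s where "s = \<bar>t\<bar>"
  have s: "s > 0" using assms by (simp add: s_def)
  have "s powr (1/3) \<le> 1 + s\<^sup>2 \<and> s * s powr (1/3) \<le> 1 + s\<^sup>2"
  proof (cases "s \<le> 1")
    case True
    then have "s powr (1/3) \<le> 1" using s by (simp add: powr_le1)
    moreover have "s * s powr (1/3) \<le> 1" using calculation True s
      by (simp add: mult_le_one)
    ultimately show ?thesis using zero_le_power2[of s] by linarith
  next
    case False
    then have 1: "s powr (1/3) \<le> s powr 1" by (intro powr_mono) auto
    then have "s * s powr (1/3) \<le> s * s" using s by simp
    moreover have "s \<le> s * s" using False by simp
    moreover have "s powr (1/3) \<le> s" using 1 s by simp
    ultimately show ?thesis unfolding power2_eq_square by linarith
  qed
  then have "1 / (1 + s\<^sup>2) \<le> 1 / s powr (1/3)" "s / (1 + s\<^sup>2) \<le> 1 / s powr (1/3)"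
    using s by (auto simp: divide_simps add_pos_nonneg split: if_splits)
  moreover have "1 / s powr (1/3) = s powr (- (1/3))" by (simp add: powr_minus_divide)
  ultimately show "1 / (1 + t\<^sup>2) \<le> \<bar>t\<bar> powr (- (1/3))" "decay t \<le> \<bar>t\<bar> powr (- (1/3))"
    by (auto simp: s_def decay_def)
qed

text \<open>The imaginary part is a wave along the real axis, damped at distance one.  The real part
  is its companion: it vanishes on the axis, and its \<open>y\<close>-derivative \<open>sin x\<close> there cancels the
  \<open>x\<close>-derivative \<open>- sin x\<close> of the imaginary part in the symmetric gradient.\<close>

definition profile :: "complex \<Rightarrow> complex" where
  "profile z = Complex (Im z * sin (Re z) / (1 + (Im z)\<^sup>2)) (cos (Re z) / (1 + (Im z)\<^sup>2))"

definition profile_x :: "complex \<Rightarrow> complex" where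
  "profile_x z = Complex (Im z * cos (Re z) / (1 + (Im z)\<^sup>2)) (- (sin (Re z) / (1 + (Im z)\<^sup>2)))"

definition profile_y :: "complex \<Rightarrow> complex" where
  "profile_y z = Complex (sin (Re z) * (1 - (Im z)\<^sup>2) / (1 + (Im z)\<^sup>2)\<^sup>2)
                         (- (2 * Im z * cos (Re z) / (1 + (Im z)\<^sup>2)\<^sup>2))"

lemma one_plus_square_neq_0 [simp]: "1 + (y::real)\<^sup>2 \<noteq> 0"
  by (metis add_pos_nonneg less_irrefl zero_le_power2 zero_less_one)

lemma has_derivative_profile:
  "(profile has_derivative (\<lambda>h. Re h *\<^sub>R profile_x z + Im h *\<^sub>R profile_y z)) (at z)"
proof -
  define q where "q = 1 + (Im z)\<^sup>2"
  have q: "q \<noteq> 0" "(Im z)\<^sup>2 = q - 1" by (auto simp: q_def)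
  have dq: "((\<lambda>z. 1 + (Im z)\<^sup>2) has_derivative (\<lambda>h. 2 * Im z * Im h)) (at z)"
    by (auto intro!: derivative_eq_intros)
  have "((\<lambda>z. Im z * sin (Re z)) has_derivative (\<lambda>h. Im h * sin (Re z) + Im z * (Re h * cos (Re z)))) (at z)"
    by (auto intro!: derivative_eq_intros simp: algebra_simps)
  from has_derivative_divide'[OF this dq]
  have "((\<lambda>z. Im z * sin (Re z) / (1 + (Im z)\<^sup>2)) has_derivative
     (\<lambda>h. ((Im h * sin (Re z) + Im z * (Re h * cos (Re z))) * q
            - Im z * sin (Re z) * (2 * Im z * Im h)) / (q * q))) (at z)"
    by (simp add: q_def)
  moreover have "((Im h * sin (Re z) + Im z * (Re h * cos (Re z))) * q
            - Im z * sin (Re z) * (2 * Im z * Im h)) / (q * q)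
      = Re h * Re (profile_x z) + Im h * Re (profile_y z)" for h
  proof -
    have "(Im h * sin (Re z) + Im z * (Re h * cos (Re z))) * q
            - Im z * sin (Re z) * (2 * Im z * Im h)
        = Re h * (Im z * cos (Re z)) * q + Im h * (sin (Re z) * (1 - (Im z)\<^sup>2))"
      unfolding q_def by (simp add: power2_eq_square algebra_simps)
    then show ?thesis
      using q(1) unfolding profile_x_def profile_y_def q_def[symmetric]
      by (simp add: power2_eq_square add_divide_distrib)
  qed
  ultimately have re: "((\<lambda>z. Im z * sin (Re z) / (1 + (Im z)\<^sup>2)) has_derivative
     (\<lambda>h. Re h * Re (profile_x z) + Im h * Re (profile_y z))) (at z)"
    by simp
  have "((\<lambda>z. cos (Re z)) has_derivative (\<lambda>h. - (Re h * sin (Re z)))) (at z)"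
    by (auto intro!: derivative_eq_intros simp: algebra_simps)
  from has_derivative_divide'[OF this dq]
  have "((\<lambda>z. cos (Re z) / (1 + (Im z)\<^sup>2)) has_derivative
     (\<lambda>h. (- (Re h * sin (Re z)) * q - cos (Re z) * (2 * Im z * Im h)) / (q * q))) (at z)"
    by (simp add: q_def)
  moreover have "(- (Re h * sin (Re z)) * q - cos (Re z) * (2 * Im z * Im h)) / (q * q)
      = Re h * Im (profile_x z) + Im h * Im (profile_y z)" for h
    using q(1) unfolding profile_x_def profile_y_def q_def[symmetric]
    by (simp add: power2_eq_square diff_divide_distrib)
  ultimately have im: "((\<lambda>z. cos (Re z) / (1 + (Im z)\<^sup>2)) has_derivative
     (\<lambda>h. Re h * Im (profile_x z) + Im h * Im (profile_y z))) (at z)"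
    by simp
  have "((\<lambda>z. complex_of_real (Im z * sin (Re z) / (1 + (Im z)\<^sup>2))
           + \<i> * complex_of_real (cos (Re z) / (1 + (Im z)\<^sup>2))) has_derivative
     (\<lambda>h. complex_of_real (Re h * Re (profile_x z) + Im h * Re (profile_y z))
        + \<i> * complex_of_real (Re h * Im (profile_x z) + Im h * Im (profile_y z)))) (at z)"
    by (intro has_derivative_add has_derivative_mult_right
        bounded_linear.has_derivative[OF bounded_linear_of_real] re im)
  moreover have "(\<lambda>z. complex_of_real (Im z * sin (Re z) / (1 + (Im z)\<^sup>2))
           + \<i> * complex_of_real (cos (Re z) / (1 + (Im z)\<^sup>2))) = profile"
    by (rule ext) (simp only: profile_def Complex_eq)
  moreover have "(\<lambda>h. complex_of_real (Re h * Re (profile_x z) + Im h * Re (profile_y z))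
        + \<i> * complex_of_real (Re h * Im (profile_x z) + Im h * Im (profile_y z)))
      = (\<lambda>h. Re h *\<^sub>R profile_x z + Im h *\<^sub>R profile_y z)"
    by (rule ext) (simp add: complex_eq_iff)
  ultimately show ?thesis by simp
qed

lemma continuous_profile_partials:
  "continuous_on UNIV profile_x" "continuous_on UNIV profile_y"
proof -
  have "continuous_on UNIV (\<lambda>z. complex_of_real (Im z * cos (Re z) / (1 + (Im z)\<^sup>2))
      + \<i> * complex_of_real (- (sin (Re z) / (1 + (Im z)\<^sup>2))))"
    by (intro continuous_intros) auto
  then show "continuous_on UNIV profile_x" by (simp only: profile_x_def[abs_def] Complex_eq)
  have "continuous_on UNIV (\<lambda>z. complex_of_real (sin (Re z) * (1 - (Im z)\<^sup>2) / (1 + (Im z)\<^sup>2)\<^sup>2)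
      + \<i> * complex_of_real (- (2 * Im z * cos (Re z) / (1 + (Im z)\<^sup>2)\<^sup>2)))"
    by (intro continuous_intros) auto
  then show "continuous_on UNIV profile_y" by (simp only: profile_y_def[abs_def] Complex_eq)
qed

lemma abs_trig_mult_le:
  "\<bar>sin x * a\<bar> \<le> \<bar>a::real\<bar>" "\<bar>cos x * a\<bar> \<le> \<bar>a\<bar>"
  using abs_sin_le_one[of x] abs_cos_le_one[of x]
  by (auto simp: abs_mult mult_left_le_one_le)

text \<open>The first three bounds concern the entries of the symmetric gradient and decay in both
  directions.  The fourth one does not decay at the axis; it controls the rotational part.\<close>

lemma profile_component_bounds:
  "\<bar>Re (profile_x z)\<bar> \<le> decay (Im z)"
  "\<bar>Im (profile_y z)\<bar> \<le> 2 * decay (Im z)"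
  "\<bar>Im (profile_x z) + Re (profile_y z)\<bar> \<le> 2 * decay (Im z)"
  "\<bar>Im (profile_x z)\<bar> \<le> 1 / (1 + (Im z)\<^sup>2)"
proof -
  define y s where "y = Im z" and "s = 1 + y\<^sup>2"
  have s: "s \<ge> 1" "s > 0" "y\<^sup>2 \<le> s" by (auto simp: s_def add_pos_nonneg)
  have y1: "2 * \<bar>y\<bar> \<le> s" using zero_le_power2[of "\<bar>y\<bar> - 1"] by (simp add: s_def power2_eq_square algebra_simps)
  have dec: "decay y = \<bar>y / s\<bar>" using s by (simp add: decay_def s_def)
  have "Re (profile_x z) = cos (Re z) * (y / s)" by (simp add: profile_x_def y_def s_def)
  then show "\<bar>Re (profile_x z)\<bar> \<le> decay (Im z)"
    using abs_trig_mult_le(2)[of "Re z" "y / s"] by (simp only: y_def[symmetric] dec)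
  have "\<bar>Im (profile_y z)\<bar> = \<bar>cos (Re z) * (2 * y / s\<^sup>2)\<bar>" by (simp add: profile_y_def y_def s_def abs_mult)
  also have "\<dots> \<le> \<bar>2 * y / s\<^sup>2\<bar>" by (rule abs_trig_mult_le)
  also have "\<dots> = 2 * \<bar>y / s\<bar> / s" using s by (simp add: abs_mult power2_eq_square)
  also have "\<dots> \<le> 2 * \<bar>y / s\<bar>" using s by (simp add: divide_le_eq mult_le_cancel_left1)
  finally show "\<bar>Im (profile_y z)\<bar> \<le> 2 * decay (Im z)" by (simp only: y_def[symmetric] dec)
  have "Im (profile_x z) + Re (profile_y z) = sin (Re z) * ((1 - y\<^sup>2) / s\<^sup>2 - 1 / s)"
    by (simp add: profile_x_def profile_y_def y_def s_def algebra_simps)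
  also have "(1 - y\<^sup>2) / s\<^sup>2 - 1 / s = - (2 * y\<^sup>2 / s\<^sup>2)"
    using s by (simp add: divide_simps power2_eq_square) (simp add: s_def power2_eq_square algebra_simps)
  finally have "\<bar>Im (profile_x z) + Re (profile_y z)\<bar> \<le> \<bar>- (2 * y\<^sup>2 / s\<^sup>2)\<bar>"
    using abs_trig_mult_le(1) by metis
  also have "\<dots> = \<bar>y / s\<bar> * (2 * \<bar>y\<bar> / s)" using s by (simp add: abs_mult power2_eq_square)
  also have "\<dots> \<le> \<bar>y / s\<bar> * 1" using y1 s by (intro mult_left_mono) auto
  finally show "\<bar>Im (profile_x z) + Re (profile_y z)\<bar> \<le> 2 * decay (Im z)"
    using decay_nonneg[of y] by (simp add: y_def[symmetric] dec)
  have "\<bar>Im (profile_x z)\<bar> = \<bar>sin (Re z) * (1 / s)\<bar>" by (simp add: profile_x_def y_def s_def)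
  also have "\<dots> \<le> \<bar>1 / s\<bar>" by (rule abs_trig_mult_le)
  finally show "\<bar>Im (profile_x z)\<bar> \<le> 1 / (1 + (Im z)\<^sup>2)" using s by (simp add: s_def y_def)
qed

lemma norm_profile_le: "norm (profile z) \<le> 2"
proof -
  define y s where "y = Im z" and "s = 1 + y\<^sup>2"
  have s: "s \<ge> 1" by (auto simp: s_def)
  have y1: "2 * \<bar>y\<bar> \<le> s" using zero_le_power2[of "\<bar>y\<bar> - 1"] by (simp add: s_def power2_eq_square algebra_simps)
  have "\<bar>Re (profile z)\<bar> = \<bar>sin (Re z) * (y / s)\<bar>" by (simp add: profile_def y_def s_def mult.commute)
  also have "\<dots> \<le> \<bar>y / s\<bar>" by (rule abs_trig_mult_le)
  also have "\<dots> \<le> 1" using y1 s by simp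
  finally have 1: "\<bar>Re (profile z)\<bar> \<le> 1" .
  have "\<bar>Im (profile z)\<bar> = \<bar>cos (Re z) * (1 / s)\<bar>" by (simp add: profile_def y_def s_def)
  also have "\<dots> \<le> \<bar>1 / s\<bar>" by (rule abs_trig_mult_le)
  also have "\<dots> \<le> 1" using s by simp
  finally show ?thesis using 1 cmod_le[of "profile z"] by linarith
qed

lemma norm_profile_partials_le:
  assumes "Im z \<noteq> 0"
  shows "norm (profile_x z) \<le> 5 * \<bar>Im z\<bar> powr (- (1/3))"
    "norm (profile_y z) \<le> 5 * \<bar>Im z\<bar> powr (- (1/3))"
  using profile_component_bounds[of z] decay_le_powr[OF assms] decay_nonneg[of "Im z"]
    cmod_le[of "profile_x z"] cmod_le[of "profile_y z"]
  by linarith+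

lemma profile_wirtinger_bounds:
  "\<bar>Re ((profile_x z - \<i> * profile_y z) / 2)\<bar> \<le> 2 * decay (Im z)"
  "norm ((profile_x z + \<i> * profile_y z) / 2) \<le> 3 * decay (Im z)"
proof -
  show "\<bar>Re ((profile_x z - \<i> * profile_y z) / 2)\<bar> \<le> 2 * decay (Im z)"
    using profile_component_bounds(1,2)[of z] decay_nonneg[of "Im z"] by simp
  show "norm ((profile_x z + \<i> * profile_y z) / 2) \<le> 3 * decay (Im z)"
    using profile_component_bounds(1,2,3)[of z] decay_nonneg[of "Im z"]
      cmod_le[of "(profile_x z + \<i> * profile_y z) / 2"] by simp
qed

section \<open>The lacunary sum and its monotonicity\<close>

definition freq :: "nat \<Rightarrow> real" where
  "freq j = 2 * pi * 8 ^ j"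

lemma freq_pos: "0 < freq j"
  by (simp add: freq_def)

definition partial_map :: "real \<Rightarrow> nat \<Rightarrow> complex \<Rightarrow> complex" where
  "partial_map e n z = z + e *\<^sub>R (\<Sum>j<n. (1 / freq j) *\<^sub>R profile (freq j *\<^sub>R z))"

definition partial_map_x :: "real \<Rightarrow> nat \<Rightarrow> complex \<Rightarrow> complex" where
  "partial_map_x e n z = 1 + e *\<^sub>R (\<Sum>j<n. profile_x (freq j *\<^sub>R z))"

definition partial_map_y :: "real \<Rightarrow> nat \<Rightarrow> complex \<Rightarrow> complex" where
  "partial_map_y e n z = \<i> + e *\<^sub>R (\<Sum>j<n. profile_y (freq j *\<^sub>R z))"

definition limit_map :: "real \<Rightarrow> complex \<Rightarrow> complex" where
  "limit_map e z = z + e *\<^sub>R (\<Sum>j. (1 / freq j) *\<^sub>R profile (freq j *\<^sub>R z))"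

text \<open>The series of derivatives converges off the real axis.  On the axis, a null set, it may diverge, and
  the infinite sum is then an unspecified value.\<close>

definition limit_map_x :: "real \<Rightarrow> complex \<Rightarrow> complex" where
  "limit_map_x e z = 1 + e *\<^sub>R (\<Sum>j. profile_x (freq j *\<^sub>R z))"

definition limit_map_y :: "real \<Rightarrow> complex \<Rightarrow> complex" where
  "limit_map_y e z = \<i> + e *\<^sub>R (\<Sum>j. profile_y (freq j *\<^sub>R z))"

lemma has_derivative_partial_map:
  "(partial_map e n has_derivative
     (\<lambda>h. Re h *\<^sub>R partial_map_x e n z + Im h *\<^sub>R partial_map_y e n z)) (at z)"
proof -
  have 1: "((\<lambda>z. (1 / freq j) *\<^sub>R profile (freq j *\<^sub>R z)) has_derivative
      (\<lambda>h. Re h *\<^sub>R profile_x (freq j *\<^sub>R z) + Im h *\<^sub>R profile_y (freq j *\<^sub>R z))) (at z)" for j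
  proof -
    have "((\<lambda>z. profile (freq j *\<^sub>R z)) has_derivative
        (\<lambda>h. Re (freq j *\<^sub>R h) *\<^sub>R profile_x (freq j *\<^sub>R z) + Im (freq j *\<^sub>R h) *\<^sub>R profile_y (freq j *\<^sub>R z))) (at z)"
      by (rule has_derivative_compose[of "\<lambda>z. freq j *\<^sub>R z", OF _ has_derivative_profile])
         (auto intro!: derivative_eq_intros)
    from has_derivative_scaleR_right[OF this, of "1 / freq j"] show ?thesis
      by (rule has_derivative_eq_rhs) (use freq_pos[of j] in \<open>simp add: fun_eq_iff scaleR_add_right\<close>)
  qed
  have "((\<lambda>z. z + e *\<^sub>R (\<Sum>j<n. (1 / freq j) *\<^sub>R profile (freq j *\<^sub>R z))) has_derivative
     (\<lambda>h. h + e *\<^sub>R (\<Sum>j<n. Re h *\<^sub>R profile_x (freq j *\<^sub>R z) + Im h *\<^sub>R profile_y (freq j *\<^sub>R z)))) (at z)"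
    by (intro has_derivative_add has_derivative_ident has_derivative_scaleR_right has_derivative_sum 1)
  then have "(partial_map e n has_derivative
     (\<lambda>h. h + e *\<^sub>R (\<Sum>j<n. Re h *\<^sub>R profile_x (freq j *\<^sub>R z) + Im h *\<^sub>R profile_y (freq j *\<^sub>R z)))) (at z)"
    unfolding partial_map_def[abs_def] .
  then show ?thesis
  proof (rule has_derivative_eq_rhs, intro ext)
    fix h
    let ?X = "\<Sum>j<n. profile_x (freq j *\<^sub>R z)" and ?Y = "\<Sum>j<n. profile_y (freq j *\<^sub>R z)"
    have "h + e *\<^sub>R (Re h *\<^sub>R ?X + Im h *\<^sub>R ?Y) = Re h *\<^sub>R (1 + e *\<^sub>R ?X) + Im h *\<^sub>R (\<i> + e *\<^sub>R ?Y)"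
      by (simp add: complex_eq_iff algebra_simps)
    then show "h + e *\<^sub>R (\<Sum>j<n. Re h *\<^sub>R profile_x (freq j *\<^sub>R z) + Im h *\<^sub>R profile_y (freq j *\<^sub>R z))
        = Re h *\<^sub>R partial_map_x e n z + Im h *\<^sub>R partial_map_y e n z"
      unfolding partial_map_x_def partial_map_y_def
      by (simp add: sum.distrib scaleR_sum_right[symmetric])
  qed
qed

lemma continuous_partial_map_partials:
  "continuous_on UNIV (partial_map_x e n)" "continuous_on UNIV (partial_map_y e n)"
  unfolding partial_map_x_def[abs_def] partial_map_y_def[abs_def]
  by (intro continuous_intros continuous_on_compose2[OF continuous_profile_partials(1)]
        continuous_on_compose2[OF continuous_profile_partials(2)]; simp)+

lemma summable_geometric_bound: "summable (\<lambda>j. 2 / freq j)"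
proof -
  have "summable (\<lambda>j. (1 / pi) * (1 / 8) ^ j :: real)"
    by (intro summable_mult summable_geometric) simp
  then show ?thesis by (simp add: freq_def field_simps)
qed

text \<open>The scaling \<open>1 / \<omega>\<^sub>j\<close> makes the series of maps converge uniformly, while each term keeps the
  gradient of the profile at the magnified point.\<close>

lemma norm_term_le: "norm ((1 / freq j) *\<^sub>R profile (freq j *\<^sub>R z)) \<le> 2 / freq j"
  using norm_profile_le[of "freq j *\<^sub>R z"] freq_pos[of j] by (simp add: divide_right_mono)

lemma summable_profile: "summable (\<lambda>j. (1 / freq j) *\<^sub>R profile (freq j *\<^sub>R z))"
  by (rule summable_comparison_test'[OF summable_geometric_bound]) (rule norm_term_le)

lemma partial_map_tendsto: "(\<lambda>n. partial_map e n z) \<longlonglongrightarrow> limit_map e z"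
  unfolding partial_map_def limit_map_def
  by (intro tendsto_intros summable_LIMSEQ summable_profile)

lemma norm_partial_map_le:
  assumes "0 \<le> e"
  shows "norm (partial_map e n z) \<le> norm z + e * (\<Sum>j. 2 / freq j)"
proof -
  have "norm (\<Sum>j<n. (1 / freq j) *\<^sub>R profile (freq j *\<^sub>R z)) \<le> (\<Sum>j<n. 2 / freq j)"
    by (rule sum_norm_le) (rule norm_term_le)
  also have "\<dots> \<le> (\<Sum>j. 2 / freq j)"
    by (rule sum_le_suminf[OF summable_geometric_bound]) (use freq_pos in \<open>auto intro: less_imp_le\<close>)
  finally show ?thesis
    unfolding partial_map_def using assms
    by (intro order_trans[OF norm_triangle_ineq] add_left_mono) (simp add: mult_left_mono)
qed

lemma continuous_limit_map: "continuous_on UNIV (limit_map e)"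
proof -
  have "uniform_limit UNIV (\<lambda>n z. \<Sum>j<n. (1 / freq j) *\<^sub>R profile (freq j *\<^sub>R z))
      (\<lambda>z. \<Sum>j. (1 / freq j) *\<^sub>R profile (freq j *\<^sub>R z)) sequentially"
    by (rule Weierstrass_m_test[OF _ summable_geometric_bound]) (rule norm_term_le)
  then have "continuous_on UNIV (\<lambda>z. \<Sum>j. (1 / freq j) *\<^sub>R profile (freq j *\<^sub>R z))"
  proof (rule uniform_limit_theorem[rotated])
    have c: "continuous_on UNIV profile"
      using has_derivative_profile by (meson continuous_at_imp_continuous_on has_derivative_continuous)
    show "\<forall>\<^sub>F n in sequentially. continuous_on UNIV (\<lambda>z. \<Sum>j<n. (1 / freq j) *\<^sub>R profile (freq j *\<^sub>R z))"
      by (intro always_eventually allI continuous_intros continuous_on_compose2[OF c]) auto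
  qed simp
  then show ?thesis unfolding limit_map_def[abs_def] by (intro continuous_intros)
qed

lemma freq_Im: "Im (freq j *\<^sub>R z) = 8 ^ j * (2 * pi * Im z)"
  by (simp add: freq_def)

lemma sum_decay_freq_le: "(\<Sum>j<n. decay (Im (freq j *\<^sub>R z))) \<le> 2"
  unfolding freq_Im by (rule sum_decay_le)

text \<open>The constant \<open>6\<close> is \<open>3 \<cdot> 2\<close>: the factor of \<open>decay\<close> for one wave times the total decay of all waves.\<close>

lemma wirtinger_partial_map_bounds:
  assumes e: "0 \<le> e"
  shows "\<bar>Re (wirtinger_z (partial_map_x e n) (partial_map_y e n) z) - 1\<bar> \<le> 6 * e"
    "norm (wirtinger_zbar (partial_map_x e n) (partial_map_y e n) z) \<le> 6 * e"
proof -
  let ?x = "\<lambda>j. profile_x (freq j *\<^sub>R z)" and ?y = "\<lambda>j. profile_y (freq j *\<^sub>R z)"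
  have "wirtinger_z (partial_map_x e n) (partial_map_y e n) z = 1 + e *\<^sub>R (\<Sum>j<n. (?x j - \<i> * ?y j) / 2)"
    unfolding wirtinger_z_def partial_map_x_def partial_map_y_def
    by (simp add: sum_divide_distrib[symmetric] sum_subtractf sum_distrib_left[symmetric]
        scaleR_conv_of_real field_simps)
  then have "\<bar>Re (wirtinger_z (partial_map_x e n) (partial_map_y e n) z) - 1\<bar>
      = e * \<bar>\<Sum>j<n. Re ((?x j - \<i> * ?y j) / 2)\<bar>"
    using e by (simp add: abs_mult)
  also have "\<dots> \<le> e * (\<Sum>j<n. 3 * decay (Im (freq j *\<^sub>R z)))"
    using e
  proof (intro mult_left_mono order_trans[OF sum_abs] sum_mono)
    fix j
    show "\<bar>Re ((?x j - \<i> * ?y j) / 2)\<bar> \<le> 3 * decay (Im (freq j *\<^sub>R z))"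
      using profile_wirtinger_bounds(1)[of "freq j *\<^sub>R z"] decay_nonneg[of "Im (freq j *\<^sub>R z)"] by linarith
  qed
  also have "\<dots> \<le> e * 6"
    using e sum_decay_freq_le[of z n] by (intro mult_left_mono) (simp_all add: sum_distrib_left[symmetric])
  finally show "\<bar>Re (wirtinger_z (partial_map_x e n) (partial_map_y e n) z) - 1\<bar> \<le> 6 * e" by simp
  have "wirtinger_zbar (partial_map_x e n) (partial_map_y e n) z = e *\<^sub>R (\<Sum>j<n. (?x j + \<i> * ?y j) / 2)"
    unfolding wirtinger_zbar_def partial_map_x_def partial_map_y_def
    by (simp add: sum_divide_distrib[symmetric] sum.distrib sum_distrib_left[symmetric]
        scaleR_conv_of_real field_simps)
  then have "norm (wirtinger_zbar (partial_map_x e n) (partial_map_y e n) z)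
      = e * norm (\<Sum>j<n. (?x j + \<i> * ?y j) / 2)"
    using e by simp
  also have "\<dots> \<le> e * (\<Sum>j<n. 3 * decay (Im (freq j *\<^sub>R z)))"
    using e by (intro mult_left_mono sum_norm_le profile_wirtinger_bounds(2))
  also have "\<dots> \<le> e * 6"
    using e sum_decay_freq_le[of z n] by (intro mult_left_mono) (simp_all add: sum_distrib_left[symmetric])
  finally show "norm (wirtinger_zbar (partial_map_x e n) (partial_map_y e n) z) \<le> 6 * e" by simp
qed

text \<open>Strong monotonicity is a closed condition, so it passes from the smooth partial sums to the limit,
  which need not be differentiable on the real axis.\<close>

lemma limit_map_strongly_monotone:
  assumes e: "0 \<le> e"
  shows "(1 - 12 * e) * (norm (z - w))\<^sup>2 \<le> (limit_map e z - limit_map e w) \<bullet> (z - w)"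
proof (rule LIMSEQ_le_const)
  show "(\<lambda>n. (partial_map e n z - partial_map e n w) \<bullet> (z - w)) \<longlonglongrightarrow> (limit_map e z - limit_map e w) \<bullet> (z - w)"
    by (intro tendsto_intros partial_map_tendsto)
  have "(1 - 12 * e) * (norm (z - w))\<^sup>2 \<le> (partial_map e n z - partial_map e n w) \<bullet> (z - w)" for n
  proof (rule strongly_monotone_if_wirtinger[OF has_derivative_partial_map])
    fix z
    show "1 - 12 * e \<le> Re (wirtinger_z (partial_map_x e n) (partial_map_y e n) z)
        - norm (wirtinger_zbar (partial_map_x e n) (partial_map_y e n) z)"
      using wirtinger_partial_map_bounds[OF e, of n z] by linarith
  qed
  then show "\<exists>N. \<forall>n\<ge>N. (1 - 12 * e) * (norm (z - w))\<^sup>2 \<le> (partial_map e n z - partial_map e n w) \<bullet> (z - w)"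
    by blast
qed

section \<open>Domination of the derivatives and Sobolev regularity\<close>

lemma powr_freq:
  "\<bar>Im (freq j *\<^sub>R z)\<bar> powr (- (1/3)) \<le> (1/2) ^ j * \<bar>Im z\<bar> powr (- (1/3))"
proof -
  have "(8::real) powr (- (1/3)) = 1 / 2"
  proof -
    have "(8::real) powr (- (1/3)) = (2 powr 3) powr (- (1/3))" by simp
    also have "\<dots> = 2 powr (-1)" by (subst powr_powr) simp
    finally show ?thesis by (simp add: powr_minus_divide)
  qed
  then have 8: "((8::real) ^ j) powr (- (1/3)) = (1/2) ^ j"
    by (induction j) (simp_all add: powr_mult)
  have "\<bar>Im (freq j *\<^sub>R z)\<bar> = 8 ^ j * (2 * pi * \<bar>Im z\<bar>)" unfolding freq_Im by (simp add: abs_mult)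
  then have "\<bar>Im (freq j *\<^sub>R z)\<bar> powr (- (1/3)) = (1/2) ^ j * ((2 * pi) powr (- (1/3)) * \<bar>Im z\<bar> powr (- (1/3)))"
    by (simp add: powr_mult 8)
  also have "\<dots> \<le> (1/2) ^ j * (1 * \<bar>Im z\<bar> powr (- (1/3)))"
  proof (intro mult_left_mono mult_right_mono)
    have "(2 * pi) powr (- (1/3)) \<le> (2 * pi) powr 0" using pi_gt3 by (intro powr_mono) auto
    then show "(2 * pi) powr (- (1/3)) \<le> 1" by simp
  qed auto
  finally show ?thesis by simp
qed

lemma norm_partials_term_le:
  assumes "Im z \<noteq> 0"
  shows "norm (profile_x (freq j *\<^sub>R z)) \<le> 5 * \<bar>Im z\<bar> powr (- (1/3)) * (1/2) ^ j"
    "norm (profile_y (freq j *\<^sub>R z)) \<le> 5 * \<bar>Im z\<bar> powr (- (1/3)) * (1/2) ^ j"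
proof -
  have "Im (freq j *\<^sub>R z) \<noteq> 0" using assms freq_pos[of j] by simp
  from norm_profile_partials_le[OF this] powr_freq[of j z]
  show "norm (profile_x (freq j *\<^sub>R z)) \<le> 5 * \<bar>Im z\<bar> powr (- (1/3)) * (1/2) ^ j"
    "norm (profile_y (freq j *\<^sub>R z)) \<le> 5 * \<bar>Im z\<bar> powr (- (1/3)) * (1/2) ^ j"
    by (simp_all add: mult.commute)
qed

lemma summable_half: "summable (\<lambda>j. c * (1/2) ^ j :: real)"
  by (intro summable_mult summable_geometric) simp

lemma sum_half_le:
  fixes c :: real
  assumes "0 \<le> c"
  shows "(\<Sum>j<n. c * (1/2) ^ j) \<le> 2 * c"
proof -
  have "(\<Sum>j<n. c * (1/2) ^ j) \<le> (\<Sum>j. c * (1/2) ^ j)"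
    using assms by (intro sum_le_suminf summable_half) auto
  also have "\<dots> = 2 * c" by (simp add: suminf_mult suminf_geometric)
  finally show ?thesis .
qed

lemma partials_tendsto:
  assumes "Im z \<noteq> 0"
  shows "(\<lambda>n. partial_map_x e n z) \<longlonglongrightarrow> limit_map_x e z"
    "(\<lambda>n. partial_map_y e n z) \<longlonglongrightarrow> limit_map_y e z"
proof -
  have s: "summable (\<lambda>j. profile_x (freq j *\<^sub>R z))" "summable (\<lambda>j. profile_y (freq j *\<^sub>R z))"
    by (rule summable_comparison_test'[OF summable_half], rule norm_partials_term_le[OF assms])+
  show "(\<lambda>n. partial_map_x e n z) \<longlonglongrightarrow> limit_map_x e z"
    "(\<lambda>n. partial_map_y e n z) \<longlonglongrightarrow> limit_map_y e z"
    unfolding partial_map_x_def limit_map_x_def partial_map_y_def limit_map_y_def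
    by (intro tendsto_intros summable_LIMSEQ s)+
qed

lemma norm_partials_le:
  assumes e: "0 \<le> e" and z: "Im z \<noteq> 0"
  shows "norm (partial_map_x e n z) \<le> 1 + 10 * e * \<bar>Im z\<bar> powr (- (1/3))"
    "norm (partial_map_y e n z) \<le> 1 + 10 * e * \<bar>Im z\<bar> powr (- (1/3))"
proof -
  let ?c = "5 * \<bar>Im z\<bar> powr (- (1/3))"
  have *: "norm (u + e *\<^sub>R s) \<le> 1 + 10 * e * \<bar>Im z\<bar> powr (- (1/3))"
    if "norm u = 1" "norm s \<le> (\<Sum>j<n. ?c * (1/2) ^ j)" for u s :: complex
  proof -
    have "norm s \<le> 2 * ?c" using that(2) sum_half_le[of ?c n] by simp
    then have "e * norm s \<le> e * (2 * ?c)" using e by (rule mult_left_mono)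
    then show ?thesis using norm_triangle_ineq[of u "e *\<^sub>R s"] that(1) e by (simp add: mult_ac)
  qed
  show "norm (partial_map_x e n z) \<le> 1 + 10 * e * \<bar>Im z\<bar> powr (- (1/3))"
    "norm (partial_map_y e n z) \<le> 1 + 10 * e * \<bar>Im z\<bar> powr (- (1/3))"
    unfolding partial_map_x_def partial_map_y_def
    by (intro * sum_norm_le norm_partials_term_le[OF z]; simp)+
qed

lemma limit_partials_measurable:
  "limit_map_x e \<in> borel_measurable lebesgue" "limit_map_y e \<in> borel_measurable lebesgue"
proof -
  have "(\<lambda>z. profile_x (freq j *\<^sub>R z)) \<in> borel_measurable borel"
    "(\<lambda>z. profile_y (freq j *\<^sub>R z)) \<in> borel_measurable borel" for j
    by (intro borel_measurable_continuous_onI continuous_on_compose2[OF continuous_profile_partials(1)]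
        continuous_on_compose2[OF continuous_profile_partials(2)] continuous_intros; simp)+
  then have "limit_map_x e \<in> borel_measurable borel" "limit_map_y e \<in> borel_measurable borel"
    unfolding limit_map_x_def[abs_def] limit_map_y_def[abs_def] by measurable
  then show "limit_map_x e \<in> borel_measurable lebesgue" "limit_map_y e \<in> borel_measurable lebesgue"
    by (auto intro: measurable_completion)
qed

lemma limit_partials_L2loc:
  assumes e: "0 \<le> e"
  shows "L2loc (limit_map_x e)" "L2loc (limit_map_y e)"
proof -
  let ?b = "\<lambda>z. 2 + 2 * (10 * e)\<^sup>2 * \<bar>Im z\<bar> powr (- (2/3))"
  have i: "set_integrable lebesgue K ?b" if "compact K" for K
    by (intro set_integral_add set_integrable_mult_right set_integrable_abs_Im_powr
        set_integrable_continuous_compact that) auto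
  have *: "a\<^sup>2 \<le> ?b z" if "a \<le> 1 + 10 * e * \<bar>Im z\<bar> powr (- (1/3))" "0 \<le> a" for a :: real and z
  proof -
    let ?t = "10 * e * \<bar>Im z\<bar> powr (- (1/3))"
    have "a\<^sup>2 \<le> (1 + ?t)\<^sup>2" using that by (rule power_mono)
    also have "\<dots> \<le> 2 + 2 * ?t\<^sup>2" using zero_le_power2[of "1 - ?t"] by (simp add: power2_eq_square algebra_simps)
    also have "?t\<^sup>2 = (10 * e)\<^sup>2 * \<bar>Im z\<bar> powr (- (2/3))"
      by (simp add: power_mult_distrib power2_eq_square powr_add[symmetric])
    finally show ?thesis by (simp add: mult.assoc)
  qed
  have "norm (limit_map_x e z) \<le> 1 + 10 * e * \<bar>Im z\<bar> powr (- (1/3))"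
    "norm (limit_map_y e z) \<le> 1 + 10 * e * \<bar>Im z\<bar> powr (- (1/3))" if "Im z \<noteq> 0" for z
    using LIMSEQ_le_const2[OF tendsto_norm[OF partials_tendsto(1)[OF that]]] norm_partials_le(1)[OF e that]
      LIMSEQ_le_const2[OF tendsto_norm[OF partials_tendsto(2)[OF that]]] norm_partials_le(2)[OF e that]
    by blast+
  then have sq: "(norm (limit_map_x e z))\<^sup>2 \<le> ?b z" "(norm (limit_map_y e z))\<^sup>2 \<le> ?b z" if "Im z \<noteq> 0" for z
    using that by (blast intro: * norm_ge_zero)+
  have "AE z in lebesgue. (norm (limit_map_x e z))\<^sup>2 \<le> ?b z"
    "AE z in lebesgue. (norm (limit_map_y e z))\<^sup>2 \<le> ?b z"
    by (rule eventually_mono[OF AE_Im_neq_0], erule sq)+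
  with i show "L2loc (limit_map_x e)" "L2loc (limit_map_y e)"
    by (auto intro!: L2loc_bounded_by[where b="?b"] limit_partials_measurable)
qed

lemma limit_map_weak_derivative:
  assumes e: "0 \<le> e"
  shows "weak_derivative 1 (limit_map e) (limit_map_x e)"
    "weak_derivative \<i> (limit_map e) (limit_map_y e)"
proof -
  define S where "S = (\<Sum>j. 2 / freq j)"
  let ?b = "\<lambda>z. (norm z + e * S + 1) + 10 * e * \<bar>Im z\<bar> powr (- (1/3))"
  have S: "0 \<le> S" unfolding S_def
    by (intro suminf_nonneg summable_geometric_bound) (use freq_pos in \<open>auto intro: less_imp_le\<close>)
  have i: "set_integrable lebesgue K ?b" if "compact K" for K
    by (intro set_integral_add(1)[where f="\<lambda>z. norm z + e * S + 1"] set_integrable_mult_right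
        set_integrable_abs_Im_powr set_integrable_continuous_compact that continuous_intros) auto
  have m: "limit_map e \<in> borel_measurable lebesgue"
    using borel_measurable_continuous_onI[OF continuous_limit_map] by (auto intro: measurable_completion)
  have bF: "AE z in lebesgue. norm (partial_map e n z) \<le> ?b z" for n
  proof (rule AE_I2)
    fix z
    have "0 \<le> 10 * e * \<bar>Im z\<bar> powr (- (1/3))" using e by simp
    then show "norm (partial_map e n z) \<le> ?b z"
      using norm_partial_map_le[OF e, of n z] unfolding S_def by linarith
  qed
  have b12: "AE z in lebesgue. norm (partial_map_x e n z) \<le> ?b z"
    "AE z in lebesgue. norm (partial_map_y e n z) \<le> ?b z" for n
  proof -
    have pos: "0 \<le> norm z + e * S" for z :: complex using e S by simp
    show "AE z in lebesgue. norm (partial_map_x e n z) \<le> ?b z"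
      using AE_Im_neq_0
    proof eventually_elim
      case (elim z)
      then show ?case using norm_partials_le(1)[OF e elim, of n] pos[of z] by linarith
    qed
    show "AE z in lebesgue. norm (partial_map_y e n z) \<le> ?b z"
      using AE_Im_neq_0
    proof eventually_elim
      case (elim z)
      then show ?case using norm_partials_le(2)[OF e elim, of n] pos[of z] by linarith
    qed
  qed
  have lim: "AE z in lebesgue. (\<lambda>n. partial_map_x e n z) \<longlonglongrightarrow> limit_map_x e z"
    "AE z in lebesgue. (\<lambda>n. partial_map_y e n z) \<longlonglongrightarrow> limit_map_y e z"
    using AE_Im_neq_0 by (auto elim!: eventually_mono intro: partials_tendsto)
  have limF: "AE z in lebesgue. (\<lambda>n. partial_map e n z) \<longlonglongrightarrow> limit_map e z"
    by (intro AE_I2 partial_map_tendsto)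
  have wd: "weak_derivative v (partial_map e n) (\<lambda>z. Re v *\<^sub>R partial_map_x e n z + Im v *\<^sub>R partial_map_y e n z)" for v n
    by (rule weak_derivative_C1[OF has_derivative_partial_map continuous_partial_map_partials])
  have wd1: "weak_derivative 1 (partial_map e n) (partial_map_x e n)"
    and wd2: "weak_derivative \<i> (partial_map e n) (partial_map_y e n)" for n
    using wd[of 1 n] wd[of \<i> n] by simp_all
  show "weak_derivative 1 (limit_map e) (limit_map_x e)"
    by (rule weak_derivative_limit[OF wd1 m limit_partials_measurable(1) limF lim(1) bF b12(1) i])
  show "weak_derivative \<i> (limit_map e) (limit_map_y e)"
    by (rule weak_derivative_limit[OF wd2 m limit_partials_measurable(2) limF lim(2) bF b12(2) i])
qed

lemma limit_map_W12loc:
  assumes "0 \<le> e"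
  shows "W12loc_partials (limit_map e) (limit_map_x e) (limit_map_y e)"
proof -
  have "L2loc (limit_map e)"
  proof (rule L2loc_bounded_by)
    show "limit_map e \<in> borel_measurable lebesgue"
      using borel_measurable_continuous_onI[OF continuous_limit_map] by (auto intro: measurable_completion)
    show "AE z in lebesgue. (norm (limit_map e z))\<^sup>2 \<le> (norm (limit_map e z))\<^sup>2" by simp
    show "set_integrable lebesgue K (\<lambda>z. (norm (limit_map e z))\<^sup>2)" if "compact K" for K
      by (intro set_integrable_continuous_compact continuous_intros continuous_limit_map that)
  qed
  then show ?thesis
    unfolding W12loc_partials_def
    using limit_partials_L2loc[OF assms] limit_map_weak_derivative[OF assms] by blast
qed

lemma wirtinger_limit_map_bounds:
  assumes e: "0 \<le> e" and z: "Im z \<noteq> 0"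
  shows "\<bar>Re (wirtinger_z (limit_map_x e) (limit_map_y e) z) - 1\<bar> \<le> 6 * e"
    "norm (wirtinger_zbar (limit_map_x e) (limit_map_y e) z) \<le> 6 * e"
proof -
  have "(\<lambda>n. \<bar>Re (wirtinger_z (partial_map_x e n) (partial_map_y e n) z) - 1\<bar>)
      \<longlonglongrightarrow> \<bar>Re (wirtinger_z (limit_map_x e) (limit_map_y e) z) - 1\<bar>"
    unfolding wirtinger_z_def by (intro tendsto_intros partials_tendsto z) auto
  then show "\<bar>Re (wirtinger_z (limit_map_x e) (limit_map_y e) z) - 1\<bar> \<le> 6 * e"
    by (rule LIMSEQ_le_const2) (use wirtinger_partial_map_bounds(1)[OF e] in blast)
  have "(\<lambda>n. norm (wirtinger_zbar (partial_map_x e n) (partial_map_y e n) z))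
      \<longlonglongrightarrow> norm (wirtinger_zbar (limit_map_x e) (limit_map_y e) z)"
    unfolding wirtinger_zbar_def by (intro tendsto_intros partials_tendsto z) auto
  then show "norm (wirtinger_zbar (limit_map_x e) (limit_map_y e) z) \<le> 6 * e"
    by (rule LIMSEQ_le_const2) (use wirtinger_partial_map_bounds(2)[OF e] in blast)
qed

section \<open>Behaviour on the real line\<close>

lemma limit_map_of_real:
  "Re (limit_map e (of_real t)) = t"
  "(\<lambda>j. cos (freq j * t) / freq j) sums (Im (limit_map e (of_real t)) / e)" if "e \<noteq> 0"
proof -
  have p: "(1 / freq j) *\<^sub>R profile (freq j *\<^sub>R complex_of_real t) = Complex 0 (cos (freq j * t) / freq j)" for j
    by (simp add: profile_def complex_eq_iff)
  have s: "(\<lambda>j. Complex 0 (cos (freq j * t) / freq j)) sums (\<Sum>j. Complex 0 (cos (freq j * t) / freq j))"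
    using summable_profile[of "of_real t"] unfolding p by (rule summable_sums)
  have l: "limit_map e (of_real t) = of_real t + e *\<^sub>R (\<Sum>j. Complex 0 (cos (freq j * t) / freq j))"
    by (simp only: limit_map_def p)
  have "(\<lambda>j. 0) sums Re (\<Sum>j. Complex 0 (cos (freq j * t) / freq j))"
    using sums_Re[OF s] by simp
  then have "Re (\<Sum>j. Complex 0 (cos (freq j * t) / freq j)) = 0"
    using sums_unique2 sums_zero by blast
  then show "Re (limit_map e (of_real t)) = t" by (simp add: l)
  show "(\<lambda>j. cos (freq j * t) / freq j) sums (Im (limit_map e (of_real t)) / e)"
    using sums_Im[OF s] that by (simp add: l)
qed

lemma abs_cos_second_difference_le:
  fixes a d :: real
  shows "\<bar>cos (a - d) + cos (a + d) - 2 * cos a\<bar> \<le> d\<^sup>2"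
proof -
  have "cos (a - d) + cos (a + d) - 2 * cos a = - (2 * cos a * (1 - cos d))"
    by (simp add: cos_add cos_diff algebra_simps)
  also have "1 - cos d = 2 * (sin (d / 2))\<^sup>2"
    using cos_double_sin[of "d / 2"] by simp
  finally have "\<bar>cos (a - d) + cos (a + d) - 2 * cos a\<bar> = 4 * \<bar>cos a\<bar> * (sin (d / 2))\<^sup>2"
    by (simp add: abs_mult)
  also have "\<dots> \<le> 4 * 1 * (d / 2)\<^sup>2"
    using abs_sin_x_le_abs_x[of "d / 2"]
    by (intro mult_mono) (auto simp: abs_le_square_iff[symmetric])
  finally show ?thesis by (simp add: power2_eq_square)
qed

text \<open>The second difference of \<open>\<Sum>\<^sub>j cos(\<omega>\<^sub>j t) / \<omega>\<^sub>j\<close> over a cell of mesh \<open>8\<^sup>-\<^sup>N\<close>, in units of \<open>8\<^sup>-\<^sup>N\<close>: terms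
  with \<open>j > N\<close> vanish because all three arguments are multiples of \<open>2 \<pi>\<close>; the term \<open>j = N\<close> equals
  \<open>4 / (2 \<pi>) > 1/2\<close>; the terms with \<open>j < N\<close> add up to at most \<open>\<pi> / 14 < 2/7\<close>.  The difference
  exceeds \<open>1/5\<close>.\<close>

lemma limit_map_bent:
  fixes N :: nat and m :: int
  assumes e: "0 < e"
  defines "v \<equiv> \<lambda>t::real. Im (limit_map e (complex_of_real t))"
  shows "e / 5 / 8 ^ N \<le> \<bar>v (m / 8 ^ N) + v ((real_of_int m + 1) / 8 ^ N) - 2 * v ((m + 1/2) / 8 ^ N)\<bar>"
proof -
  define T where "T j = (cos (freq j * (m / 8 ^ N)) + cos (freq j * ((real_of_int m + 1) / 8 ^ N))
      - 2 * cos (freq j * ((m + 1/2) / 8 ^ N))) / freq j" for j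
  define D where "D = v (m / 8 ^ N) + v ((real_of_int m + 1) / 8 ^ N) - 2 * v ((m + 1/2) / 8 ^ N)"
  have e0: "e \<noteq> 0" using e by simp
  have "T sums (v (m / 8 ^ N) / e + v ((real_of_int m + 1) / 8 ^ N) / e - 2 * (v ((m + 1/2) / 8 ^ N) / e))"
    using sums_diff[OF sums_add[OF limit_map_of_real(2)[OF e0, of "m / 8 ^ N"]
          limit_map_of_real(2)[OF e0, of "(real_of_int m + 1) / 8 ^ N"]]
        sums_mult[OF limit_map_of_real(2)[OF e0, of "(m + 1/2) / 8 ^ N"], of 2]]
    unfolding T_def v_def by (simp add: add_divide_distrib diff_divide_distrib)
  also have "v (m / 8 ^ N) / e + v ((real_of_int m + 1) / 8 ^ N) / e - 2 * (v ((m + 1/2) / 8 ^ N) / e) = D / e"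
    by (simp add: D_def add_divide_distrib diff_divide_distrib)
  finally have sT: "T sums (D / e)" .
  have high: "T j = 0" if Nj: "N < j" for j
  proof -
    obtain i where j: "j = N + Suc i" using less_imp_Suc_add[OF Nj] by auto
    have "freq j * (m / 8 ^ N) = 2 * pi * of_int (8 ^ Suc i * m)"
      "freq j * ((real_of_int m + 1) / 8 ^ N) = 2 * pi * of_int (8 ^ Suc i * (m + 1))"
      "freq j * ((m + 1/2) / 8 ^ N) = 2 * pi * of_int (8 ^ i * (8 * m + 4))"
      by (simp_all add: j freq_def power_add field_simps)
    then show ?thesis unfolding T_def by (simp only: cos_int_2pin) simp
  qed
  have mid: "T N = 4 / freq N"
  proof -
    have "freq N * (m / 8 ^ N) = 2 * pi * of_int m"
      "freq N * ((real_of_int m + 1) / 8 ^ N) = 2 * pi * of_int (m + 1)"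
      "freq N * ((m + 1/2) / 8 ^ N) = 2 * pi * of_int m + pi"
      by (simp_all add: freq_def field_simps)
    then show ?thesis unfolding T_def by (simp only: cos_int_2pin cos_periodic_pi) simp
  qed
  have low: "\<bar>T j\<bar> \<le> (pi / 2 / 64 ^ N) * 8 ^ j" for j
  proof -
    let ?a = "freq j * ((m + 1/2) / 8 ^ N)" and ?d = "freq j / (2 * 8 ^ N)"
    have "freq j * (m / 8 ^ N) = ?a - ?d" "freq j * ((real_of_int m + 1) / 8 ^ N) = ?a + ?d"
      by (simp_all add: field_simps)
    then have "\<bar>T j\<bar> = \<bar>cos (?a - ?d) + cos (?a + ?d) - 2 * cos ?a\<bar> / freq j"
      using freq_pos[of j] by (simp add: T_def)
    also have "\<dots> \<le> ?d\<^sup>2 / freq j"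
      using abs_cos_second_difference_le freq_pos[of j] by (intro divide_right_mono) auto
    also have "\<dots> = (pi / 2 / 64 ^ N) * 8 ^ j"
      using freq_pos[of j]
      by (simp add: power2_eq_square freq_def power_mult_distrib[symmetric])
    finally show ?thesis .
  qed
  have "D / e = (\<Sum>j<Suc N. T j)"
    by (rule sums_unique2[OF sT sums_finite]) (use high in auto)
  then have D: "D / e = (\<Sum>j<N. T j) + 4 / freq N" by (simp add: mid)
  have "\<bar>\<Sum>j<N. T j\<bar> \<le> (\<Sum>j<N. (pi / 2 / 64 ^ N) * 8 ^ j)"
    by (rule order_trans[OF sum_abs sum_mono]) (rule low)
  also have "\<dots> = (pi / 2 / 64 ^ N) * ((8 ^ N - 1) / 7)"
    unfolding sum_distrib_left[symmetric] by (simp add: sum_gp_strict field_simps)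
  also have "\<dots> \<le> (pi / 2 / 64 ^ N) * (8 ^ N / 7)"
    by (intro mult_left_mono divide_right_mono) auto
  also have "\<dots> = pi / 14 / 8 ^ N"
    by (simp add: power_mult_distrib[symmetric] field_simps)
  also have "\<dots> \<le> (2 / 7) / 8 ^ N"
    using pi_less_4 by (intro divide_right_mono) auto
  finally have "\<bar>\<Sum>j<N. T j\<bar> \<le> (2 / 7) / 8 ^ N" .
  moreover have "(1 / 2) / 8 ^ N \<le> 4 / freq N"
    using pi_less_4 by (simp add: freq_def field_simps)
  moreover have "(1 / 2) / 8 ^ N - (2 / 7) / 8 ^ N \<ge> (1 / 5) / (8::real) ^ N"
    by (simp add: field_simps)
  ultimately have "(1 / 5) / 8 ^ N \<le> D / e" unfolding D by linarith
  then have "e / 5 / 8 ^ N \<le> D" using e by (simp add: field_simps)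
  then show ?thesis unfolding D_def by linarith
qed

section \<open>The example\<close>

theorem theorem1p5:
  fixes k :: real
  assumes "0 < k" and "k < 1"
  shows "\<exists>f fx fy :: complex \<Rightarrow> complex.
           reduced_quasiconformal f \<and>
           W12loc_partials f fx fy \<and>
           reduced_ineq k fx fy \<and>
           (\<forall>a b :: real. a < b \<longrightarrow> \<not> bounded_variation_on a b (\<lambda>t. f (complex_of_real t))) \<and>
           Linfty (wirtinger_zbar fx fy) \<and>
           Linfty (\<lambda>z. Re (wirtinger_z fx fy z)) \<and>
           (\<forall>x :: real. Re (f (complex_of_real x)) = x)"
proof -
  \<comment> \<open>The equation \<open>6 e = k (1 - 6 e)\<close> determines this value: \<open>6 e\<close> bounds both \<open>|f\<^sub>z\<^sub>b\<^sub>a\<^sub>r|\<close> and the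
    deviation of \<open>Re f\<^sub>z\<close> from \<open>1\<close>.\<close>
  define e where "e = k / (6 * (1 + k))"
  have e: "0 < e" "12 * e < 1" using assms by (auto simp: e_def field_simps)
  have ek: "6 * e \<le> k * (1 - 6 * e)" using assms by (simp add: e_def field_simps)
  have e0: "0 \<le> e" "e \<noteq> 0" using e by auto
  let ?f = "limit_map e" and ?x = "limit_map_x e" and ?y = "limit_map_y e"
  have W: "W12loc_partials ?f ?x ?y" by (rule limit_map_W12loc[OF e0(1)])
  have R: "reduced_ineq k ?x ?y"
    unfolding reduced_ineq_def using AE_Im_neq_0
  proof eventually_elim
    case (elim z)
    have "k * (1 - 6 * e) \<le> k * Re (wirtinger_z ?x ?y z)"
      using wirtinger_limit_map_bounds(1)[OF e0(1) elim] assms by (intro mult_left_mono) auto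
    then show ?case using wirtinger_limit_map_bounds(2)[OF e0(1) elim] ek by linarith
  qed
  have "\<exists>g. homeomorphism UNIV UNIV ?f g"
    by (rule strongly_monotone_homeomorphism[OF _ limit_map_strongly_monotone[OF e0(1)] continuous_limit_map])
       (use e in simp)
  then have Q: "reduced_quasiconformal ?f"
    unfolding reduced_quasiconformal_def using W R assms by blast
  have re: "Re (?f (complex_of_real x)) = x" for x by (rule limit_map_of_real(1)[OF e0(2)])
  have V: "\<not> bounded_variation_on a b (\<lambda>t. ?f (complex_of_real t))" if "a < b" for a b
  proof (rule not_bounded_variation_if_bent[OF re _ limit_map_bent[OF e(1)] that])
    show "0 < e / 5" using e by simp
  qed
  note m = limit_partials_measurable[of e]
  have L1: "Linfty (wirtinger_zbar ?x ?y)"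
    unfolding Linfty_def
  proof (intro conjI exI)
    show "wirtinger_zbar ?x ?y \<in> borel_measurable lebesgue"
      unfolding wirtinger_zbar_def[abs_def] using m by measurable
    show "AE z in lebesgue. norm (wirtinger_zbar ?x ?y z) \<le> 6 * e"
      using AE_Im_neq_0 by eventually_elim (rule wirtinger_limit_map_bounds(2)[OF e0(1)])
  qed
  have L2: "Linfty (\<lambda>z. Re (wirtinger_z ?x ?y z))"
    unfolding Linfty_def
  proof (intro conjI exI)
    show "(\<lambda>z. Re (wirtinger_z ?x ?y z)) \<in> borel_measurable lebesgue"
      unfolding wirtinger_z_def[abs_def] using m by measurable
    show "AE z in lebesgue. norm (Re (wirtinger_z ?x ?y z)) \<le> 1 + 6 * e"
      using AE_Im_neq_0
    proof eventually_elim
      case (elim z)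
      then show ?case using wirtinger_limit_map_bounds(1)[OF e0(1) elim] by simp
    qed
  qed
  from Q W R V L1 L2 re show ?thesis by blast
qed

end
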